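(* Let $G$ be a Lie group with identity element $e$, and let $H \subset G$ and $K \subset G$ be Lie subgroups such that $G$ is the (internal) Zappa–Szép product of $H$ and $K$, i.e. $G = HK$ and $H \cap K = \{e\}$. Let $\mathfrak{g}$, $\mathfrak{h}$ and $\mathfrak{k}$ be the Lie algebras of $G$, $H$ and $K$, respectively, with $\mathfrak{h}$ and $\mathfrak{k}$ regarded as Lie subalgebras of $\mathfrak{g}$. Then $$\mathfrak{g} = \mathfrak{h} \oplus \mathfrak{k}$$ as a direct sum of vector subspaces.
   Context: A group $G$ with identity $e$ is an (internal) Zappa–Szép product of subgroups $H$ and $K$ if $G = HK = \{hk : h \in H,\ k \in K\}$ and $H \cap K = \{e\}$; neither $H$ nor $K$ is required to be normal. Lie groups are real and finite-dimensional, with the usual convention that manifolds (including Lie subgroups with their own manifold structure) are Hausdorff and second countable. The Lie algebra of a Lie group is its tangent space at the identity with the Lie bracket. The direct sum is one of vector spaces, not necessarily of Lie algebras ($[\mathfrak{h},\mathfrak{k}] = 0$ is not claimed). *)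

theory Defs
  imports
    "HOL-Analysis.Analysis"
    "HOL-Algebra.Coset"
    "HOL-Library.Function_Algebras"
begin

section \<open>Linear preliminaries\<close>

instantiation "fun" :: (type, real_vector) real_vector
begin

definition scaleR_fun_def: "r *\<^sub>R f = (\<lambda>x. r *\<^sub>R f x)"

instance
  by standard (simp_all add: scaleR_fun_def fun_eq_iff algebra_simps)

end

definition is_direct_sum :: "'v::real_vector set \<Rightarrow> 'v set \<Rightarrow> 'v set \<Rightarrow> bool" where
  "is_direct_sum V S T \<longleftrightarrow>
     subspace V \<and> subspace S \<and> subspace T \<and>
     V = {s + t | s t. s \<in> S \<and> t \<in> T} \<and> S \<inter> T = {0}"

text \<open>
  Manifolds below are modelled on a finite-dimensional real normed space, given as a type of class
  \<^class>\<open>real_normed_vector\<close>. The class \<^class>\<open>euclidean_space\<close> would exclude dimension 0, hence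
  discrete Lie groups and the trivial subgroup. The following instance is a model space of
  dimension zero.
\<close>

instantiation unit :: real_normed_vector
begin

definition plus_unit :: "unit \<Rightarrow> unit \<Rightarrow> unit" where "plus_unit x y = ()"
definition zero_unit :: unit where "zero_unit = ()"
definition scaleR_unit :: "real \<Rightarrow> unit \<Rightarrow> unit" where "scaleR_unit r x = ()"
definition norm_unit :: "unit \<Rightarrow> real" where "norm_unit x = 0"
definition dist_unit :: "unit \<Rightarrow> unit \<Rightarrow> real" where "dist_unit x y = 0"
definition sgn_unit :: "unit \<Rightarrow> unit" where "sgn_unit x = ()"
definition uniformity_unit :: "(unit \<times> unit) filter" where
  "uniformity_unit = (INF e\<in>{0<..}. principal {(x, y). dist x y < e})"
definition open_unit :: "unit set \<Rightarrow> bool" where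
  "open_unit U \<longleftrightarrow> (\<forall>x\<in>U. eventually (\<lambda>(x', y). x' = x \<longrightarrow> y \<in> U) uniformity)"

instance
  by standard
     (simp_all add: norm_unit_def dist_unit_def uniformity_unit_def open_unit_def)

end

section \<open>Smooth maps between open subsets of normed spaces\<close>

text \<open>
  Only used for open \<open>S\<close> and finite-dimensional spaces: there a map is \<open>C\<^sup>k\<^sup>+\<^sup>1\<close> iff it is
  differentiable and \<open>x \<mapsto> Df(x) v\<close> is \<open>C\<^sup>k\<close> for each fixed vector \<open>v\<close>.
\<close>

fun Ck_on :: "nat \<Rightarrow> 'e set \<Rightarrow> ('e::real_normed_vector \<Rightarrow> 'f::real_normed_vector) \<Rightarrow> bool" where
  "Ck_on 0 S f \<longleftrightarrow> continuous_on S f"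
| "Ck_on (Suc k) S f \<longleftrightarrow>
     (\<forall>x\<in>S. f differentiable (at x)) \<and>
     (\<forall>v. Ck_on k S (\<lambda>x. frechet_derivative f (at x) v))"

definition smooth_on :: "'e set \<Rightarrow> ('e::real_normed_vector \<Rightarrow> 'f::real_normed_vector) \<Rightarrow> bool" where
  "smooth_on S f \<longleftrightarrow> (\<forall>k. Ck_on k S f)"

section \<open>Smooth manifolds\<close>

text \<open>A chart \<open>(U, \<phi>)\<close>; the values of \<open>\<phi>\<close> outside \<open>U\<close> are irrelevant.\<close>

type_synonym ('a, 'e) chart = "'a set \<times> ('a \<Rightarrow> 'e)"

abbreviation chart_inv :: "('a, 'e) chart \<Rightarrow> 'e \<Rightarrow> 'a" where
  "chart_inv c \<equiv> inv_into (fst c) (snd c)"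

record ('a, 'e) manifold =
  mtop :: "'a topology"
  atlas :: "('a, 'e) chart set"

text \<open>
  The atlas need not be maximal: it represents the smooth structure that it generates, and none of
  the notions below depends on the choice of atlas for that structure.
\<close>

locale smooth_manifold =
  fixes M :: "('a, 'e::real_normed_vector) manifold"
  assumes finite_dim_model: "\<exists>B. finite B \<and> span B = (UNIV :: 'e set)"
    and hausdorff: "Hausdorff_space (mtop M)"
    and second_countable: "second_countable (mtop M)"
    and chart_open: "c \<in> atlas M \<Longrightarrow> openin (mtop M) (fst c)"
    and chart_open_image: "c \<in> atlas M \<Longrightarrow> open (snd c ` fst c)"
    and chart_homeo: "c \<in> atlas M \<Longrightarrow>
      homeomorphic_map (subtopology (mtop M) (fst c)) (top_of_set (snd c ` fst c)) (snd c)"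
    and charts_cover: "(\<Union>c\<in>atlas M. fst c) = topspace (mtop M)"
    and charts_compatible: "c \<in> atlas M \<Longrightarrow> d \<in> atlas M \<Longrightarrow>
      smooth_on (snd c ` (fst c \<inter> fst d)) (snd d \<circ> chart_inv c)"

definition product_manifold ::
  "('a, 'e) manifold \<Rightarrow> ('b, 'f) manifold \<Rightarrow> ('a \<times> 'b, 'e \<times> 'f) manifold" where
  "product_manifold M N =
     \<lparr>mtop = prod_topology (mtop M) (mtop N),
      atlas = {(fst c \<times> fst d, map_prod (snd c) (snd d)) | c d. c \<in> atlas M \<and> d \<in> atlas N}\<rparr>"

definition smooth_map ::
  "('a, 'e::real_normed_vector) manifold \<Rightarrow> ('b, 'f::real_normed_vector) manifold \<Rightarrow>
   ('a \<Rightarrow> 'b) \<Rightarrow> bool" where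
  "smooth_map M N f \<longleftrightarrow>
     continuous_map (mtop M) (mtop N) f \<and>
     (\<forall>c\<in>atlas M. \<forall>d\<in>atlas N.
        smooth_on (snd c ` {x \<in> fst c. f x \<in> fst d}) (snd d \<circ> f \<circ> chart_inv c))"

section \<open>Tangent spaces and differentials\<close>

definition charts_at :: "('a, 'e) manifold \<Rightarrow> 'a \<Rightarrow> ('a, 'e) chart set" where
  "charts_at M p = {c \<in> atlas M. p \<in> fst c}"

text \<open>
  A tangent vector at \<open>p\<close> is a class of triples \<open>(U, \<phi>, v)\<close> with \<open>(U, \<phi>)\<close> a chart at \<open>p\<close> and \<open>v\<close> a
  vector of the model space, where \<open>(U, \<phi>, v)\<close> and \<open>(V, \<psi>, w)\<close> are identified if
  \<open>w = D(\<psi> \<circ> \<phi>\<^sup>-\<^sup>1)(\<phi>(p)) v\<close>. Such a class contains exactly one triple for each chart at \<open>p\<close>, so it is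
  a function from charts to vectors; the vector space operations are then the pointwise ones. The
  function is set to 0 on all other arguments to make it unique.
\<close>

type_synonym ('a, 'e) tangent_vector = "('a, 'e) chart \<Rightarrow> 'e"

definition tangent_space ::
  "('a, 'e::real_normed_vector) manifold \<Rightarrow> 'a \<Rightarrow> ('a, 'e) tangent_vector set" where
  "tangent_space M p =
     {v. (\<forall>c. c \<notin> charts_at M p \<longrightarrow> v c = 0) \<and>
         (\<forall>c\<in>charts_at M p. \<forall>d\<in>charts_at M p.
            v d = frechet_derivative (snd d \<circ> chart_inv c) (at (snd c p)) (v c))}"

text \<open>For smooth \<open>f\<close> the differential at \<open>p\<close> does not depend on the chart chosen at \<open>p\<close>.\<close>

definition differential ::
  "('a, 'e::real_normed_vector) manifold \<Rightarrow> ('b, 'f::real_normed_vector) manifold \<Rightarrow>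
   ('a \<Rightarrow> 'b) \<Rightarrow> 'a \<Rightarrow> ('a, 'e) tangent_vector \<Rightarrow> ('b, 'f) tangent_vector" where
  "differential M N f p v =
     (\<lambda>d. if d \<in> charts_at N (f p)
          then let c = (SOME c. c \<in> charts_at M p)
               in frechet_derivative (snd d \<circ> f \<circ> chart_inv c) (at (snd c p)) (v c)
          else 0)"

definition immersion ::
  "('a, 'e::real_normed_vector) manifold \<Rightarrow> ('b, 'f::real_normed_vector) manifold \<Rightarrow>
   ('a \<Rightarrow> 'b) \<Rightarrow> bool" where
  "immersion M N f \<longleftrightarrow>
     smooth_map M N f \<and>
     (\<forall>p\<in>topspace (mtop M). inj_on (differential M N f p) (tangent_space M p))"

text \<open>
  In a chart \<open>c\<close>, the commutator of vector fields has coordinates \<open>DY\<^sub>c \<cdot> X\<^sub>c - DX\<^sub>c \<cdot> Y\<^sub>c\<close>. This is the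
  sign convention under which \<open>[X, Y] f = X (Y f) - Y (X f)\<close>.
\<close>

definition vector_field_bracket ::
  "('a, 'e::real_normed_vector) manifold \<Rightarrow>
   ('a \<Rightarrow> ('a, 'e) tangent_vector) \<Rightarrow> ('a \<Rightarrow> ('a, 'e) tangent_vector) \<Rightarrow>
   'a \<Rightarrow> ('a, 'e) tangent_vector" where
  "vector_field_bracket M X Y p =
     (\<lambda>c. if c \<in> charts_at M p
          then frechet_derivative (\<lambda>x. Y (chart_inv c x) c) (at (snd c p)) (X p c)
             - frechet_derivative (\<lambda>x. X (chart_inv c x) c) (at (snd c p)) (Y p c)
          else 0)"

section \<open>Lie groups, Lie subgroups and Lie algebras\<close>

locale lie_group = group G + smooth_manifold M
  for G :: "('a, 'm) monoid_scheme" (structure)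
    and M :: "('a, 'e::real_normed_vector) manifold" +
  assumes topspace_eq_carrier: "topspace (mtop M) = carrier G"
    and smooth_mult: "smooth_map (product_manifold M M) M (\<lambda>(x, y). x \<otimes> y)"
    and smooth_inv: "smooth_map M M (\<lambda>x. inv x)"

text \<open>
  A Lie subgroup carries a manifold structure \<open>N\<close> of its own, for which the inclusion is an
  immersion. Its topology may be finer than the subspace topology, and it need not be closed.
\<close>

definition lie_subgroup ::
  "('a, 'm) monoid_scheme \<Rightarrow> ('a, 'e::real_normed_vector) manifold \<Rightarrow>
   'a set \<Rightarrow> ('a, 'f::real_normed_vector) manifold \<Rightarrow> bool" where
  "lie_subgroup G M H N \<longleftrightarrow>
     subgroup H G \<and> lie_group (G\<lparr>carrier := H\<rparr>) N \<and> immersion N M (\<lambda>x. x)"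

definition zappa_szep_product :: "('a, 'm) monoid_scheme \<Rightarrow> 'a set \<Rightarrow> 'a set \<Rightarrow> bool" where
  "zappa_szep_product G H K \<longleftrightarrow>
     subgroup H G \<and> subgroup K G \<and> carrier G = H <#>\<^bsub>G\<^esub> K \<and> H \<inter> K = {\<one>\<^bsub>G\<^esub>}"

record 'v lie_alg = "'v partial_object" +
  bracket :: "'v \<Rightarrow> 'v \<Rightarrow> 'v"

definition left_invariant_field ::
  "('a, 'm) monoid_scheme \<Rightarrow> ('a, 'e::real_normed_vector) manifold \<Rightarrow>
   ('a, 'e) tangent_vector \<Rightarrow> 'a \<Rightarrow> ('a, 'e) tangent_vector" where
  "left_invariant_field G M v g = differential M M (\<lambda>x. g \<otimes>\<^bsub>G\<^esub> x) \<one>\<^bsub>G\<^esub> v"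

definition lie_algebra ::
  "('a, 'm) monoid_scheme \<Rightarrow> ('a, 'e::real_normed_vector) manifold \<Rightarrow>
   ('a, 'e) tangent_vector lie_alg" where
  "lie_algebra G M =
     \<lparr>carrier = tangent_space M \<one>\<^bsub>G\<^esub>,
      bracket = (\<lambda>v w. vector_field_bracket M
        (left_invariant_field G M v) (left_invariant_field G M w) \<one>\<^bsub>G\<^esub>)\<rparr>"

text \<open>
  The Lie algebra of a Lie subgroup regarded as a subset of the Lie algebra of the group, through
  the differential of the inclusion at the identity.
\<close>

definition lie_subalgebra_of ::
  "('a, 'm) monoid_scheme \<Rightarrow> ('a, 'e::real_normed_vector) manifold \<Rightarrow>
   'a set \<Rightarrow> ('a, 'f::real_normed_vector) manifold \<Rightarrow> ('a, 'e) tangent_vector set" where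
  "lie_subalgebra_of G M H N =
     differential N M (\<lambda>x. x) \<one>\<^bsub>G\<^esub> ` carrier (lie_algebra (G\<lparr>carrier := H\<rparr>) N)"

end

theory Submission
  imports Defs
begin

text \<open>
  The multiplication \<open>\<mu> : H \<times> K \<rightarrow> G\<close> is a smooth bijection, and its differential at \<open>(e, e)\<close> is
  \<open>(u, w) \<mapsto> u + w\<close> on \<open>\<hh> \<times> \<kk>\<close>; it has to be shown that this is bijective onto \<open>\<gg>\<close>. Since \<open>\<mu>\<close> is
  continuous and injective, invariance of domain gives \<open>dim \<hh> + dim \<kk> \<le> dim \<gg>\<close>, so surjectivity
  suffices. As \<open>\<mu>(x, y) = a \<mu>(a\<^sup>-\<^sup>1 x, y b\<^sup>-\<^sup>1) b\<close>, the differential of \<open>\<mu>\<close> at any \<open>(a, b)\<close> factors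
  through the one at \<open>(e, e)\<close>. If the latter is not surjective, then every point is critical, and by
  Sard's theorem, applied in countably many charts, the image of \<open>\<mu>\<close> is a null set; but it is all of \<open>G\<close>.
\<close>

section \<open>Finite-dimensional normed spaces\<close>

text \<open>
  Indexes the coordinates of a finite-dimensional space \<open>'v\<close>, so that theorems about
  \<^typ>\<open>real ^ 'n\<close> can be transferred to \<open>'v\<close>. The index 0 only keeps the type
  nonempty and is superfluous exactly when \<open>'v\<close> has positive dimension.
\<close>

typedef (overloaded) ('v::real_normed_vector) coord_index =
  "{i::nat. i = 0 \<or> i < dim (UNIV :: 'v set)}"
  by blast

instance coord_index :: (real_normed_vector) finite
proof
  have "Rep_coord_index i \<in> {..dim (UNIV :: 'a set)}" for i :: "'a coord_index"
    using Rep_coord_index[of i] by auto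
  then have "finite (range (Rep_coord_index :: 'a coord_index \<Rightarrow> nat))"
    by (intro finite_subset[OF _ finite_atMost]) blast
  then show "finite (UNIV :: 'a coord_index set)"
    by (rule finite_imageD) (simp add: inj_on_def Rep_coord_index_inject)
qed

text \<open>\<open>baby_Sard\<close> is stated for vectors indexed by finite well-ordered types, so
  the indices inherit the order of the natural numbers.\<close>

instantiation coord_index :: (real_normed_vector) wellorder
begin

definition "i \<le> j \<longleftrightarrow> Rep_coord_index i \<le> Rep_coord_index j"
definition "i < j \<longleftrightarrow> Rep_coord_index i < Rep_coord_index j"

instance
proof
  fix P :: "'a coord_index \<Rightarrow> bool" and i
  assume step: "\<And>x. (\<And>y. y < x \<Longrightarrow> P y) \<Longrightarrow> P x"
  show "P i"
    by (induction "Rep_coord_index i" arbitrary: i rule: less_induct)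
      (auto intro: step simp: less_coord_index_def)
qed (auto simp: less_eq_coord_index_def less_coord_index_def Rep_coord_index_inject)

end

section \<open>Bases and coordinate isomorphisms\<close>

lemma finite_dim_basis:
  assumes "\<exists>B. finite B \<and> span B = (UNIV :: 'v::real_vector set)"
  obtains B :: "'v::real_vector set"
  where "finite B" "independent B" "span B = UNIV" "card B = dim (UNIV :: 'v::real_vector set)"
proof -
  obtain C where C: "finite C" "span C = (UNIV :: 'v set)" using assms by blast
  obtain B :: "'v set" where B: "independent B" "UNIV \<subseteq> span B" "card B = dim (UNIV :: 'v set)"
    by (rule basis_exists[of "UNIV :: 'v set"])
  have "finite B"
    using independent_span_bound[OF C(1) B(1)] C(2) by auto
  with B that show thesis by blast
qed

lemma card_coord_index:
  assumes "\<exists>B. finite B \<and> span B = (UNIV :: 'v::real_normed_vector set)" and "\<exists>v :: 'v. v \<noteq> 0"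
  shows "CARD('v coord_index) = dim (UNIV :: 'v set)"
proof -
  obtain B :: "'v set" where B: "finite B" "span B = UNIV" "card B = dim (UNIV :: 'v set)"
    using finite_dim_basis[OF assms(1)] by metis
  then have "B \<noteq> {}" using assms(2) by auto
  then have pos: "dim (UNIV :: 'v set) > 0"
    using B by (metis card_gt_0_iff)
  have "CARD('v coord_index) = card {i::nat. i = 0 \<or> i < dim (UNIV :: 'v set)}"
    using type_definition.card[OF type_definition_coord_index[where 'v = 'v]] .
  also have "{i::nat. i = 0 \<or> i < dim (UNIV :: 'v set)} = {..<dim (UNIV :: 'v set)}"
    using pos by auto
  finally show ?thesis by simp
qed

text \<open>On the compact unit sphere \<open>norm (P x)\<close> attains a minimum \<open>m\<close>,
  positive because \<open>P\<close> is injective. By homogeneity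
  \<open>m * norm x \<le> norm (P x)\<close> for all \<open>x\<close>, which bounds \<open>Q\<close>
  by \<open>1 / m\<close>.\<close>

lemma linear_inverse_bounded:
  fixes P :: "'a::euclidean_space \<Rightarrow> 'v::real_normed_vector"
  assumes "linear P" and PQ: "\<And>y. P (Q y) = y" and QP: "\<And>x. Q (P x) = x"
  shows "bounded_linear Q"
proof -
  interpret P: bounded_linear P using assms(1) by (simp add: linear_conv_bounded_linear)
  have "continuous_on (sphere 0 1) (\<lambda>x. norm (P x))"
    by (intro continuous_intros P.continuous_on)
  \<comment> \<open>Euclidean spaces have positive dimension, so the unit sphere is nonempty and a
    minimum exists.\<close>
  moreover have "sphere (0::'a) 1 \<noteq> {}"
    using sphere_eq_empty[of "0::'a" 1] by simp
  ultimately obtain z where z: "z \<in> sphere 0 1" "\<And>x. x \<in> sphere 0 1 \<Longrightarrow> norm (P z) \<le> norm (P x)"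
    using continuous_attains_inf[OF compact_sphere] by blast
  define m where "m = norm (P z)"
  have "P z \<noteq> 0"
    using z(1) QP[of z] QP[of 0] P.zero by auto
  then have m: "m > 0" by (simp add: m_def)
  have below: "m * norm x \<le> norm (P x)" for x
  proof (cases "x = 0")
    case False
    then have "m \<le> norm (P (x /\<^sub>R norm x))"
      unfolding m_def by (intro z) simp
    also have "\<dots> = norm (P x) / norm x"
      by (simp add: P.scaleR divide_inverse_commute)
    finally show ?thesis using False by (simp add: field_simps)
  qed (simp add: P.zero)
  show ?thesis
  proof (rule bounded_linear_intro)
    fix x y and r :: real
    show "Q (x + y) = Q x + Q y"
      using QP[of "Q x + Q y"] by (simp add: P.add PQ)
    show "Q (r *\<^sub>R x) = r *\<^sub>R Q x"
      using QP[of "r *\<^sub>R Q x"] by (simp add: P.scaleR PQ)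
    show "norm (Q y) \<le> norm y * (1 / m)"
      using below[of "Q y"] m by (simp add: PQ field_simps)
  qed
qed

text \<open>Coordinate vectors go to linear combinations of a basis enumerated by \<open>b\<close>:
  independence makes this injective, spanning makes it surjective, and
  \<open>linear_inverse_bounded\<close> makes it an isomorphism of normed spaces.\<close>

lemma finite_dim_coordinates:
  assumes fin: "\<exists>B. finite B \<and> span B = (UNIV :: 'v::real_normed_vector set)" and nz: "\<exists>v :: 'v. v \<noteq> 0"
  obtains P :: "real ^ ('v::real_normed_vector coord_index) \<Rightarrow> 'v::real_normed_vector"
    and Q where "bounded_linear P" "bounded_linear Q" "\<And>y. P (Q y) = y" "\<And>x. Q (P x) = x"
proof -
  obtain B :: "'v set" where B: "finite B" "independent B" "span B = UNIV" "card B = dim (UNIV :: 'v set)"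
    using finite_dim_basis[OF fin] by metis
  obtain b where b: "bij_betw b (UNIV :: 'v coord_index set) B"
    using finite_same_card_bij[of "UNIV :: 'v coord_index set" B] B card_coord_index[OF fin nz] by auto
  define P :: "real ^ ('v coord_index) \<Rightarrow> 'v" where "P x = (\<Sum>i\<in>UNIV. (x $ i) *\<^sub>R b i)" for x
  have lin: "linear P"
    by (rule linearI) (simp_all add: P_def algebra_simps sum.distrib scaleR_sum_right)
  \<comment> \<open>Summing over basis vectors instead of indices gives the form in which
    independence and span of a finite set are expressed.\<close>
  have P_eq: "P x = (\<Sum>v\<in>B. (x $ inv_into UNIV b v) *\<^sub>R v)" for x
    using sum.reindex_bij_betw[OF b, of "\<lambda>v. (x $ inv_into UNIV b v) *\<^sub>R v"] b
    by (simp add: P_def bij_betw_def)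
  have "inj P"
  proof (rule linear_injective_0[OF lin, THEN iffD2], safe)
    fix x assume "P x = 0"
    then have 0: "\<And>v. v \<in> B \<Longrightarrow> x $ inv_into UNIV b v = 0"
      using independentD[OF B(2,1) subset_refl, of "\<lambda>v. x $ inv_into UNIV b v"] by (simp add: P_eq)
    have "x $ i = 0" for i
      using 0[of "b i"] b by (auto simp: bij_betw_def)
    then show "x = 0" by (simp add: vec_eq_iff)
  qed
  moreover have "surj P"
  proof -
    have "\<exists>x. P x = y" for y
    proof -
      have "y \<in> range (\<lambda>u. \<Sum>v\<in>B. u v *\<^sub>R v)"
        using span_finite[OF B(1)] B(3) by simp
      then obtain u where "y = (\<Sum>v\<in>B. u v *\<^sub>R v)" ..
      then have "P (\<chi> i. u (b i)) = y"
        unfolding P_eq using b by (auto simp: bij_betw_def f_inv_into_f intro!: sum.cong)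
      then show ?thesis ..
    qed
    then show ?thesis by (metis surj_def)
  qed
  ultimately obtain Q where "\<And>y. P (Q y) = y" "\<And>x. Q (P x) = x"
    by (metis injD surjD)
  with lin that show thesis
    by (meson linear_inverse_bounded linear_conv_bounded_linear)
qed

section \<open>Invariance of dimension and Sard's theorem on abstract finite-dimensional
  spaces\<close>

lemma invariance_of_dimension_finite_dim:
  fixes f :: "'v::real_normed_vector \<Rightarrow> 'w::real_normed_vector"
  assumes fv: "\<exists>B. finite B \<and> span B = (UNIV :: 'v set)" "\<exists>v :: 'v. v \<noteq> 0"
    and fw: "\<exists>B. finite B \<and> span B = (UNIV :: 'w set)" "\<exists>w :: 'w. w \<noteq> 0"
    and f: "open U" "U \<noteq> {}" "continuous_on U f" "inj_on f U"
  shows "dim (UNIV :: 'v set) \<le> dim (UNIV :: 'w set)"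
proof -
  obtain P :: "real ^ ('v coord_index) \<Rightarrow> 'v" and P'
    where P: "bounded_linear P" "\<And>y. P (P' y) = y" "\<And>x. P' (P x) = x"
    using finite_dim_coordinates[OF fv] by metis
  obtain Q :: "real ^ ('w coord_index) \<Rightarrow> 'w" and Q'
    where Q: "bounded_linear Q'" "\<And>y. Q (Q' y) = y"
    using finite_dim_coordinates[OF fw] by metis
  have "CARD('v coord_index) \<le> CARD('w coord_index)"
  proof -
    have "dim (UNIV :: (real ^ ('v coord_index)) set) \<le> dim (UNIV :: (real ^ ('w coord_index)) set)"
    proof (rule invariance_of_dimension_subspaces)
      show "openin (top_of_set UNIV) (P -` U)"
        using open_vimage[OF f(1) linear_continuous_on[OF P(1)]] by simp
      have "continuous_on (P -` U) (f \<circ> P)"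
        using P(1) by (intro continuous_on_compose linear_continuous_on continuous_on_subset[OF f(3)]) auto
      then show "continuous_on (P -` U) (Q' \<circ> (f \<circ> P))"
        using Q(1) by (rule continuous_on_compose[OF _ linear_continuous_on])
      show "inj_on (Q' \<circ> (f \<circ> P)) (P -` U)"
        using P(3) Q(2) f(4) unfolding inj_on_def by (metis comp_apply vimageE)
      show "P -` U \<noteq> {}"
        using P(2) f(2) by (metis empty_iff equals0I vimageI2)
    qed auto
    then show ?thesis by (simp add: dim_UNIV)
  qed
  then show ?thesis by (simp add: card_coord_index fv fw)
qed

text \<open>In coordinates the images of the \<open>S i\<close> consist of critical values, hence
  are null sets by \<open>baby_Sard\<close>; the inequality of dimensions is what lets mere
  differentiability suffice there. A countable union of null sets is null and contains no nonempty
  open set. Concluding with an open set keeps Lebesgue measure out of the abstract spaces.\<close>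

lemma Sard_finite_dim:
  fixes f :: "'i \<Rightarrow> 'v::real_normed_vector \<Rightarrow> 'w::real_normed_vector"
  assumes fv: "\<exists>B. finite B \<and> span B = (UNIV :: 'v set)" "\<exists>v :: 'v. v \<noteq> 0"
    and fw: "\<exists>B. finite B \<and> span B = (UNIV :: 'w set)" "\<exists>w :: 'w. w \<noteq> 0"
    and dim: "dim (UNIV :: 'v set) \<le> dim (UNIV :: 'w set)"
    and I: "countable I"
    and D: "\<And>i x. i \<in> I \<Longrightarrow> x \<in> S i \<Longrightarrow> \<exists>D. (f i has_derivative D) (at x) \<and> \<not> surj D"
    and W: "open W" "W \<subseteq> (\<Union>i\<in>I. f i ` S i)"
  shows "W = {}"
proof -
  obtain P :: "real ^ ('v coord_index) \<Rightarrow> 'v" and P'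
    where P: "bounded_linear P" "\<And>y. P (P' y) = y"
    using finite_dim_coordinates[OF fv] by metis
  obtain Q :: "real ^ ('w coord_index) \<Rightarrow> 'w" and Q'
    where Q: "bounded_linear Q" "\<And>y. Q (Q' y) = y" "bounded_linear Q'" "\<And>x. Q' (Q x) = x"
    using finite_dim_coordinates[OF fw] by metis
  obtain D where D: "\<And>i x. i \<in> I \<Longrightarrow> x \<in> S i \<Longrightarrow> (f i has_derivative D i x) (at x)"
    "\<And>i x. i \<in> I \<Longrightarrow> x \<in> S i \<Longrightarrow> \<not> surj (D i x)"
    using D by metis
  have "negligible ((Q' \<circ> f i \<circ> P) ` (P -` S i))" if i: "i \<in> I" for i
  proof (rule baby_Sard)
    show "CARD('v coord_index) \<le> CARD('w coord_index)"
      using dim by (simp add: card_coord_index fv fw)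
  next
    fix y assume y: "y \<in> P -` S i"
    show *: "(Q' \<circ> f i \<circ> P has_derivative (Q' \<circ> D i (P y) \<circ> P)) (at y within P -` S i)"
      using y D(1)[OF i, of "P y"]
        bounded_linear_imp_has_derivative[OF P(1)] bounded_linear_imp_has_derivative[OF Q(3)]
      unfolding o_assoc[symmetric]
      by (auto intro!: diff_chain_within intro: has_derivative_at_withinI)
    have lin: "linear (Q' \<circ> D i (P y) \<circ> P)"
      using has_derivative_linear[OF *] .
    have "\<not> surj (Q' \<circ> D i (P y) \<circ> P)"
    proof
      assume s: "surj (Q' \<circ> D i (P y) \<circ> P)"
      have "surj (D i (P y))"
      proof -
        have "\<exists>x. w = D i (P y) x" for w
        proof -
          obtain x where "Q' w = Q' (D i (P y) (P x))" using s unfolding surj_def by auto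
          then have "w = D i (P y) (P x)" by (metis Q(2))
          then show ?thesis ..
        qed
        then show ?thesis by (simp add: surj_def)
      qed
      with D(2)[OF i, of "P y"] y show False by simp
    qed
    then show "rank (matrix (Q' \<circ> D i (P y) \<circ> P)) < CARD('w coord_index)"
      using lin full_rank_surjective[of "matrix (Q' \<circ> D i (P y) \<circ> P)"]
        rank_bound[of "matrix (Q' \<circ> D i (P y) \<circ> P)"]
      by (simp add: matrix_works order.strict_iff_order)
  qed
  then have "negligible (\<Union>i\<in>I. (Q' \<circ> f i \<circ> P) ` (P -` S i))"
    using I by (intro negligible_countable_Union) auto
  moreover have "Q -` W \<subseteq> (\<Union>i\<in>I. (Q' \<circ> f i \<circ> P) ` (P -` S i))"
  proof
    fix y assume "y \<in> Q -` W"
    then obtain i x where ix: "i \<in> I" "x \<in> S i" "Q y = f i x" using W by blast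
    obtain z where "x = P z" using P(2) by metis
    moreover have "y = Q' (f i x)" using ix(3) Q(4) by metis
    ultimately show "y \<in> (\<Union>i\<in>I. (Q' \<circ> f i \<circ> P) ` (P -` S i))" using ix by auto
  qed
  ultimately have "negligible (Q -` W)" by (rule negligible_subset)
  moreover have "open (Q -` W)"
    using open_vimage[OF W(1) linear_continuous_on[OF Q(1)]] .
  ultimately have "Q -` W = {}" using open_not_negligible by blast
  then show ?thesis using Q(2) by (metis empty_iff equals0I vimageI2)
qed

section \<open>Products with the real line and dimension counts\<close>

lemma finite_dim_prod:
  assumes "\<exists>B. finite B \<and> span B = (UNIV :: 'v::real_vector set)"
    and "\<exists>C. finite C \<and> span C = (UNIV :: 'w::real_vector set)"
  shows "\<exists>B. finite B \<and> span B = (UNIV :: ('v \<times> 'w) set)"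
proof -
  obtain B :: "'v set" and C :: "'w set" where BC: "finite B" "span B = UNIV" "finite C" "span C = UNIV"
    using assms by blast
  let ?E = "(\<lambda>v. (v, 0)) ` B \<union> (\<lambda>w. (0, w)) ` C :: ('v \<times> 'w) set"
  have l: "linear (\<lambda>v::'v. (v, 0::'w))" "linear (\<lambda>w::'w. (0::'v, w))"
    by (auto intro: linearI)
  have "(v, w) \<in> span ?E" for v w
  proof -
    have "(v, 0::'w) \<in> span ((\<lambda>v. (v, 0)) ` B)" "(0::'v, w) \<in> span ((\<lambda>w. (0, w)) ` C)"
      using BC linear_span_image[OF l(1), of B] linear_span_image[OF l(2), of C] by simp_all
    then have "(v, 0) \<in> span ?E" "(0, w) \<in> span ?E"
      using span_mono[of _ ?E] by blast+
    then have "(v, 0) + (0, w) \<in> span ?E" by (rule span_add)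
    then show ?thesis by simp
  qed
  then have "span ?E = UNIV" by auto
  moreover have "finite ?E" using BC by simp
  ultimately show ?thesis by blast
qed

lemma finite_dim_real: "\<exists>B. finite B \<and> span B = (UNIV :: real set)"
  using span_Basis[where 'a = real] finite_Basis by blast

lemma prod_real_nonzero: "\<exists>v :: 'v::real_normed_vector \<times> real. v \<noteq> 0"
  by (intro exI[of _ "(0, 1)"]) (simp add: zero_prod_def)

text \<open>
  Multiplying all spaces by \<^typ>\<open>real\<close> makes the dimensions positive, so that spaces of
  dimension 0 need no separate treatment.
\<close>

lemma dim_le_of_injective:
  fixes f :: "'v::real_normed_vector \<Rightarrow> 'w::real_normed_vector"
  assumes fv: "\<exists>B. finite B \<and> span B = (UNIV :: 'v set)"
    and fw: "\<exists>B. finite B \<and> span B = (UNIV :: 'w set)"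
    and f: "open U" "U \<noteq> {}" "continuous_on U f" "inj_on f U"
  shows "dim (UNIV :: ('v \<times> real) set) \<le> dim (UNIV :: ('w \<times> real) set)"
proof (rule invariance_of_dimension_finite_dim[OF finite_dim_prod[OF fv finite_dim_real] prod_real_nonzero
      finite_dim_prod[OF fw finite_dim_real] prod_real_nonzero])
  show "open (U \<times> (UNIV :: real set))" using f(1) by (intro open_Times) auto
  have "continuous_on (U \<times> (UNIV :: real set)) (\<lambda>z. (f (fst z), snd z))"
    by (intro continuous_intros continuous_on_compose2[OF f(3)]) auto
  then show "continuous_on (U \<times> (UNIV :: real set)) (map_prod f id)"
    by (simp add: map_prod_def case_prod_unfold)
  show "inj_on (map_prod f id) (U \<times> (UNIV :: real set))"
    using f(4) by (intro map_prod_inj_on) auto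
qed (use f(2) in simp)

text \<open>The product of \<open>f i\<close> with the identity of the reals has the product of
  \<open>D\<close> with the identity as derivative, which is onto only if \<open>D\<close> is. So
  critical points stay critical, and \<open>W\<close> may be replaced by its product with the
  line.\<close>

lemma open_subset_critical_values_empty:
  fixes f :: "'i \<Rightarrow> 'v::real_normed_vector \<Rightarrow> 'w::real_normed_vector"
  assumes fv: "\<exists>B. finite B \<and> span B = (UNIV :: 'v set)"
    and fw: "\<exists>B. finite B \<and> span B = (UNIV :: 'w set)"
    and dim: "dim (UNIV :: ('v \<times> real) set) \<le> dim (UNIV :: ('w \<times> real) set)"
    and I: "countable I"
    and D: "\<And>i x. i \<in> I \<Longrightarrow> x \<in> S i \<Longrightarrow> \<exists>D. (f i has_derivative D) (at x) \<and> \<not> surj D"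
    and W: "open W" "W \<subseteq> (\<Union>i\<in>I. f i ` S i)"
  shows "W = {}"
proof -
  have "W \<times> (UNIV :: real set) = {}"
  proof (rule Sard_finite_dim[OF finite_dim_prod[OF fv finite_dim_real] prod_real_nonzero
        finite_dim_prod[OF fw finite_dim_real] prod_real_nonzero dim I,
        where f = "\<lambda>i z. (f i (fst z), snd z)" and S = "\<lambda>i. S i \<times> UNIV"])
    fix i and z :: "'v \<times> real" assume i: "i \<in> I" and z: "z \<in> S i \<times> UNIV"
    obtain D where D: "(f i has_derivative D) (at (fst z))" "\<not> surj D"
      using D[OF i, of "fst z"] z unfolding mem_Times_iff by blast
    have "((\<lambda>z. (f i (fst z), snd z)) has_derivative (\<lambda>z. (D (fst z), snd z))) (at z)"
      using D(1) by (intro has_derivative_Pair has_derivative_snd[OF has_derivative_ident]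
          has_derivative_compose[OF has_derivative_fst[OF has_derivative_ident]])
    moreover have "\<not> surj (\<lambda>z :: 'v \<times> real. (D (fst z), snd z))"
      using D(2) unfolding surj_def by (metis fst_conv)
    ultimately show "\<exists>D. ((\<lambda>z. (f i (fst z), snd z)) has_derivative D) (at z) \<and> \<not> surj D"
      by blast
  next
    show "W \<times> (UNIV :: real set) \<subseteq> (\<Union>i\<in>I. (\<lambda>z. (f i (fst z), snd z)) ` (S i \<times> UNIV))"
    proof clarify
      fix w and t :: real assume "w \<in> W"
      then obtain i x where "i \<in> I" "x \<in> S i" "w = f i x" using W(2) by blast
      then show "(w, t) \<in> (\<Union>i\<in>I. (\<lambda>z. (f i (fst z), snd z)) ` (S i \<times> UNIV))"
        by (intro UN_I[of i] image_eqI[of _ _ "(x, t)"]) auto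
    qed
    show "open (W \<times> (UNIV :: real set))" using W(1) by (intro open_Times) auto
  qed
  then show ?thesis by simp
qed

text \<open>Extend a nonzero kernel vector \<open>x\<close> to a basis \<open>B\<close>. Since
  \<open>D x = 0\<close>, the images of the other \<open>card B - 1\<close> vectors already span the
  codomain, too few for its dimension.\<close>

lemma surj_linear_imp_inj:
  fixes D :: "'v::real_vector \<Rightarrow> 'w::real_vector"
  assumes fv: "\<exists>B. finite B \<and> span B = (UNIV :: 'v set)"
    and dim: "dim (UNIV :: 'v set) \<le> dim (UNIV :: 'w set)"
    and D: "linear D" "surj D"
  shows "inj D"
proof (rule ccontr)
  assume "\<not> inj D"
  then obtain x where x: "D x = 0" "x \<noteq> 0"
    using linear_injective_0[OF D(1)] by blast
  obtain E :: "'v set" where E: "finite E" "span E = UNIV" using fv by blast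
  obtain B where B: "{x} \<subseteq> B" "independent B" "UNIV \<subseteq> span B"
    using maximal_independent_subset_extend[of "{x}" UNIV] x(2) by auto
  have finB: "finite B"
    using independent_span_bound[OF E(1) B(2)] E(2) by simp
  have cardB: "card B = dim (UNIV :: 'v set)"
    using B by (intro basis_card_eq_dim) auto
  have "UNIV = D ` span B" using D(2) B(3) by auto
  also have "\<dots> = span (D ` B)" using linear_span_image[OF D(1)] by simp
  also have "D ` B = insert 0 (D ` (B - {x}))" using B(1) x(1) by auto
  finally have sp: "span (D ` (B - {x})) = UNIV" by (simp add: span_insert_0)
  obtain C :: "'w set" where C: "independent C" "card C = dim (UNIV :: 'w set)"
    using basis_exists[of "UNIV :: 'w set"] by metis
  have "card C \<le> card (D ` (B - {x}))"
    using independent_span_bound[OF _ C(1), of "D ` (B - {x})"] finB sp by simp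
  also have "\<dots> \<le> card (B - {x})" using finB by (intro card_image_le) auto
  also have "\<dots> < card B" using finB B(1) by (intro psubset_card_mono) auto
  finally show False using C(2) cardB dim by simp
qed

text \<open>The comparison of dimensions is available after adding a real factor, so the previous
  lemma is applied to the product of \<open>D\<close> with the identity of that factor.\<close>

lemma surj_linear_imp_inj_prod_real:
  fixes D :: "'v::real_vector \<Rightarrow> 'w::real_vector"
  assumes fv: "\<exists>B. finite B \<and> span B = (UNIV :: 'v set)"
    and dim: "dim (UNIV :: ('v \<times> real) set) \<le> dim (UNIV :: ('w \<times> real) set)"
    and D: "linear D" "surj D"
  shows "inj D"
proof -
  have inj: "inj (map_prod D (id :: real \<Rightarrow> real))"
  proof (rule surj_linear_imp_inj[OF finite_dim_prod[OF fv finite_dim_real] dim])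
    show "linear (map_prod D (id :: real \<Rightarrow> real))"
      using D(1) by (auto intro!: linearI simp: linear_add linear_scale)
    show "surj (map_prod D (id :: real \<Rightarrow> real))"
      using D(2) map_prod_surj surj_id by blast
  qed
  show ?thesis
  proof (rule injI)
    fix x y assume "D x = D y"
    then have "map_prod D id (x, 0 :: real) = map_prod D id (y, 0)" by simp
    then show "x = y" using injD[OF inj] by blast
  qed
qed

section \<open>Derivatives in charts\<close>

text \<open>
  The eventuality says that \<open>f\<close> maps a neighbourhood of \<open>p\<close> into the domain of \<open>d\<close>; without it the
  coordinate expression of \<open>f\<close> would involve junk values and the chain rule would fail.
\<close>

definition has_chart_deriv ::
  "('a, 'e::real_normed_vector) chart \<Rightarrow> ('b, 'f::real_normed_vector) chart \<Rightarrow>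
   ('a \<Rightarrow> 'b) \<Rightarrow> 'a \<Rightarrow> ('e \<Rightarrow> 'f) \<Rightarrow> bool" where
  "has_chart_deriv c d f p D \<longleftrightarrow>
     p \<in> fst c \<and> f p \<in> fst d \<and> inj_on (snd c) (fst c) \<and> inj_on (snd d) (fst d) \<and>
     (\<forall>\<^sub>F x in nhds (snd c p). x \<in> snd c ` fst c \<and> f (chart_inv c x) \<in> fst d) \<and>
     (snd d \<circ> f \<circ> chart_inv c has_derivative D) (at (snd c p))"

lemma has_chart_deriv_linear: "has_chart_deriv c d f p D \<Longrightarrow> linear D"
  by (auto simp: has_chart_deriv_def has_derivative_linear)

lemma has_chart_deriv_unique:
  "has_chart_deriv c d f p D \<Longrightarrow> has_chart_deriv c d f p E \<Longrightarrow> D = E"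
  by (auto simp: has_chart_deriv_def dest: has_derivative_unique)

lemma has_chart_deriv_cong:
  assumes "has_chart_deriv c d f p D" and "\<And>x. x \<in> fst c \<Longrightarrow> f x = g x"
  shows "has_chart_deriv c d g p D"
proof -
  note h = assms(1)[unfolded has_chart_deriv_def]
  have ev: "\<forall>\<^sub>F x in nhds (snd c p). f (chart_inv c x) = g (chart_inv c x)"
    using h assms(2) by (auto elim!: eventually_mono simp: inv_into_into)
  have "\<forall>\<^sub>F x in nhds (snd c p). x \<in> snd c ` fst c \<and> g (chart_inv c x) \<in> fst d"
    using h ev by (auto elim: eventually_elim2)
  moreover have "(snd d \<circ> g \<circ> chart_inv c has_derivative D) (at (snd c p))"
    using h ev assms(2)
    by (auto intro!: has_derivative_transform_eventually[of _ D "snd c p" UNIV "snd d \<circ> g \<circ> chart_inv c"]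
        elim!: eventually_mono simp: eventually_at_filter inv_into_f_f)
  moreover have "g p \<in> fst d" using h assms(2)[of p] by simp
  ultimately show ?thesis
    using h by (simp add: has_chart_deriv_def)
qed

text \<open>The coordinate expressions of \<open>f\<close> and \<open>g\<close> compose to that of
  \<open>g \<circ> f\<close> only where \<open>f\<close> stays inside the middle chart
  \<open>d\<close>. This holds near \<open>p\<close>, and derivatives depend only on values near the
  point.\<close>

lemma has_chart_deriv_chain:
  assumes f: "has_chart_deriv c d f p D" and g: "has_chart_deriv d e g (f p) E"
  shows "has_chart_deriv c e (g \<circ> f) p (E \<circ> D)"
proof -
  note hf = f[unfolded has_chart_deriv_def] and hg = g[unfolded has_chart_deriv_def]
  let ?F = "snd d \<circ> f \<circ> chart_inv c"
  have Fp: "?F (snd c p) = snd d (f p)" using hf by simp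
  have der: "((snd e \<circ> g \<circ> chart_inv d) \<circ> ?F has_derivative E \<circ> D) (at (snd c p))"
    using hf hg Fp by (intro diff_chain_at) simp_all
  \<comment> \<open>Differentiability makes \<open>?F\<close> continuous at the point, so the
    neighbourhood on which \<open>g\<close> lands in \<open>fst e\<close> can be pulled back through
    \<open>f\<close>.\<close>
  have "(?F \<longlongrightarrow> snd d (f p)) (nhds (snd c p))"
    using hf Fp has_derivative_continuous[of ?F D "snd c p" UNIV]
    unfolding continuous_at tendsto_at_iff_tendsto_nhds by metis
  moreover have "\<forall>\<^sub>F y in nhds (snd d (f p)). g (chart_inv d y) \<in> fst e"
    using hg by (auto elim: eventually_mono)
  ultimately have 1: "\<forall>\<^sub>F x in nhds (snd c p). g (chart_inv d (?F x)) \<in> fst e"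
    by (rule eventually_compose_filterlim[rotated])
  have 2: "\<forall>\<^sub>F x in nhds (snd c p). x \<in> snd c ` fst c \<and> f (chart_inv c x) \<in> fst d \<and>
      chart_inv d (?F x) = f (chart_inv c x)"
    using hf by (auto elim!: eventually_mono)
  have "\<forall>\<^sub>F x in nhds (snd c p). x \<in> snd c ` fst c \<and> (g \<circ> f) (chart_inv c x) \<in> fst e"
    using 1 2 by eventually_elim auto
  moreover have "(snd e \<circ> (g \<circ> f) \<circ> chart_inv c has_derivative E \<circ> D) (at (snd c p))"
  proof (rule has_derivative_transform_eventually[OF der])
    show "\<forall>\<^sub>F x in at (snd c p). ((snd e \<circ> g \<circ> chart_inv d) \<circ> ?F) x = (snd e \<circ> (g \<circ> f) \<circ> chart_inv c) x"
      using 2 unfolding eventually_at_filter by eventually_elim auto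
    show "((snd e \<circ> g \<circ> chart_inv d) \<circ> ?F) (snd c p) = (snd e \<circ> (g \<circ> f) \<circ> chart_inv c) (snd c p)"
      using hf hg by simp
  qed simp
  ultimately show ?thesis
    using hf hg by (simp add: has_chart_deriv_def)
qed

section \<open>Product charts, open charts and differentiability of smooth maps\<close>

abbreviation prod_chart ::
  "('a, 'e) chart \<Rightarrow> ('b, 'f) chart \<Rightarrow> ('a \<times> 'b, 'e \<times> 'f) chart" where
  "prod_chart c d \<equiv> (fst c \<times> fst d, map_prod (snd c) (snd d))"

lemma chart_inv_prod_chart:
  assumes "inj_on (snd c) (fst c)" "inj_on (snd d) (fst d)"
    and "x \<in> snd c ` fst c" "y \<in> snd d ` fst d"
  shows "inv_into (fst c \<times> fst d) (map_prod (snd c) (snd d)) (x, y) = (chart_inv c x, chart_inv d y)"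
  by (rule inv_into_f_eq) (use assms in \<open>auto simp: inj_on_def\<close>)

lemma has_chart_deriv_map_prod:
  assumes f: "has_chart_deriv c c' f p D" and g: "has_chart_deriv d d' g q E"
  shows "has_chart_deriv (prod_chart c d) (prod_chart c' d') (map_prod f g) (p, q) (map_prod D E)"
proof -
  note hf = f[unfolded has_chart_deriv_def] and hg = g[unfolded has_chart_deriv_def]
  let ?F = "snd c' \<circ> f \<circ> chart_inv c" and ?G = "snd d' \<circ> g \<circ> chart_inv d"
  have inj: "inj_on (map_prod (snd c) (snd d)) (fst c \<times> fst d)"
    "inj_on (map_prod (snd c') (snd d')) (fst c' \<times> fst d')"
    using hf hg by (auto intro!: map_prod_inj_on)
  have ev: "\<forall>\<^sub>F z in nhds (snd c p, snd d q).
      (fst z \<in> snd c ` fst c \<and> f (chart_inv c (fst z)) \<in> fst c') \<and>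
      (snd z \<in> snd d ` fst d \<and> g (chart_inv d (snd z)) \<in> fst d')"
    unfolding nhds_prod using hf hg by (intro eventually_prodI) simp_all
  have "\<forall>\<^sub>F z in nhds (snd c p, snd d q). z \<in> map_prod (snd c) (snd d) ` (fst c \<times> fst d) \<and>
      map_prod f g (chart_inv (prod_chart c d) z) \<in> fst c' \<times> fst d'"
    using ev by eventually_elim
      (use hf hg in \<open>auto simp: chart_inv_prod_chart map_prod_surj_on\<close>)
  moreover have "(map_prod (snd c') (snd d') \<circ> map_prod f g \<circ> chart_inv (prod_chart c d)
      has_derivative map_prod D E) (at (snd c p, snd d q))"
  proof (rule has_derivative_transform_eventually)
    show "((\<lambda>z. (?F (fst z), ?G (snd z))) has_derivative map_prod D E) (at (snd c p, snd d q))"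
    proof -
      have "(?F has_derivative D) (at (fst (snd c p, snd d q)))"
        "(?G has_derivative E) (at (snd (snd c p, snd d q)))" using hf hg by simp_all
      then have "((\<lambda>z. (?F (fst z), ?G (snd z))) has_derivative (\<lambda>z. (D (fst z), E (snd z))))
          (at (snd c p, snd d q))"
        by (intro has_derivative_Pair; intro has_derivative_compose[OF has_derivative_fst[OF has_derivative_ident]]
            has_derivative_compose[OF has_derivative_snd[OF has_derivative_ident]])
      then show ?thesis by (simp add: map_prod_def case_prod_unfold)
    qed
    show "\<forall>\<^sub>F z in at (snd c p, snd d q). (?F (fst z), ?G (snd z)) =
        (map_prod (snd c') (snd d') \<circ> map_prod f g \<circ> chart_inv (prod_chart c d)) z"
      using ev unfolding eventually_at_filter by eventually_elim
        (use hf hg in \<open>auto simp: chart_inv_prod_chart\<close>)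
    show "(?F (fst (snd c p, snd d q)), ?G (snd (snd c p, snd d q))) =
        (map_prod (snd c') (snd d') \<circ> map_prod f g \<circ> chart_inv (prod_chart c d)) (snd c p, snd d q)"
      using hf hg by (simp add: chart_inv_prod_chart)
  qed simp
  ultimately show ?thesis
    using hf hg inj by (simp add: has_chart_deriv_def)
qed

text \<open>The topological content of a chart in a form that passes directly to product charts.
  Openness of \<open>snd c\<close> is continuity of \<open>chart_inv c\<close> on the image.\<close>

definition open_chart :: "'a topology \<Rightarrow> ('a, 'e::real_normed_vector) chart \<Rightarrow> bool" where
  "open_chart X c \<longleftrightarrow> openin X (fst c) \<and> inj_on (snd c) (fst c) \<and>
     (\<forall>U. openin X U \<longrightarrow> U \<subseteq> fst c \<longrightarrow> open (snd c ` U))"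

lemma (in smooth_manifold) open_chart_atlas:
  assumes c: "c \<in> atlas M"
  shows "open_chart (mtop M) c"
proof -
  have sub: "fst c \<subseteq> topspace (mtop M)"
    using chart_open[OF c] by (rule openin_subset)
  have "inj_on (snd c) (fst c)"
    using homeomorphic_imp_injective_map[OF chart_homeo[OF c]] sub by (simp add: inf_absorb2)
  moreover have "open (snd c ` U)" if "openin (mtop M) U" "U \<subseteq> fst c" for U
  proof -
    have "openin (subtopology (mtop M) (fst c)) U"
      using that by (auto simp: openin_subtopology)
    then have "openin (top_of_set (snd c ` fst c)) (snd c ` U)"
      using homeomorphic_imp_open_map[OF chart_homeo[OF c]] by (simp add: open_map_def)
    then show ?thesis
      using chart_open_image[OF c] by (metis openin_open_eq)
  qed
  ultimately show ?thesis
    using chart_open[OF c] by (simp add: open_chart_def)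
qed

lemma open_chart_prod_chart:
  assumes c: "open_chart X c" and d: "open_chart Y d"
  shows "open_chart (prod_topology X Y) (prod_chart c d)"
proof -
  note hc = c[unfolded open_chart_def] and hd = d[unfolded open_chart_def]
  have "inj_on (map_prod (snd c) (snd d)) (fst c \<times> fst d)"
    using hc hd by (auto intro!: map_prod_inj_on)
  moreover have "open (map_prod (snd c) (snd d) ` W)"
    if W: "openin (prod_topology X Y) W" "W \<subseteq> fst c \<times> fst d" for W
  \<comment> \<open>An open \<open>W\<close> need not be a box, but it contains a box around each of
    its points, and the image of a box is a product of two open sets.\<close>
  proof (rule Topological_Spaces.openI)
    fix z assume "z \<in> map_prod (snd c) (snd d) ` W"
    then obtain x y where xy: "(x, y) \<in> W" "z = (snd c x, snd d y)" by auto
    obtain U V where UV: "openin X U" "openin Y V" "x \<in> U" "y \<in> V" "U \<times> V \<subseteq> W"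
      using W(1)[unfolded openin_prod_topology_alt, rule_format, OF xy(1)] by blast
    then have "U \<subseteq> fst c" "V \<subseteq> fst d" using W(2) by auto
    then have "open (snd c ` U \<times> snd d ` V)"
      using hc hd UV by (intro open_Times) auto
    moreover have "snd c ` U \<times> snd d ` V \<subseteq> map_prod (snd c) (snd d) ` W"
      using UV(5) by (metis map_prod_surj_on image_mono)
    ultimately show "\<exists>T. open T \<and> z \<in> T \<and> T \<subseteq> map_prod (snd c) (snd d) ` W"
      using xy UV by blast
  qed
  ultimately show ?thesis
    using hc hd by (simp add: open_chart_def openin_prod_Times_iff)
qed

text \<open>Asking the charts to be \<open>open_chart\<close>, instead of placing \<open>M\<close>
  and \<open>N\<close> in \<open>smooth_manifold\<close>, makes this applicable to
  \<open>product_manifold M M\<close> once its product charts are known to be open.\<close>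

lemma smooth_map_has_chart_deriv:
  assumes f: "smooth_map M N f"
    and c: "c \<in> atlas M" "open_chart (mtop M) c" and d: "d \<in> atlas N" "open_chart (mtop N) d"
    and p: "p \<in> fst c" "f p \<in> fst d"
  obtains D where "has_chart_deriv c d f p D"
proof -
  note hc = c(2)[unfolded open_chart_def] and hd = d(2)[unfolded open_chart_def]
  let ?S = "{x \<in> fst c. f x \<in> fst d}"
  have "?S = {x \<in> topspace (mtop M). f x \<in> fst d} \<inter> fst c"
    using hc openin_subset by blast
  then have "openin (mtop M) ?S"
    using f hc hd by (auto simp: smooth_map_def intro: openin_continuous_map_preimage)
  then have "open (snd c ` ?S)" using hc by auto
  moreover have "snd c p \<in> snd c ` ?S" using p by auto
  ultimately have "\<forall>\<^sub>F x in nhds (snd c p). x \<in> snd c ` ?S"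
    by (rule eventually_nhds_in_open)
  then have ev: "\<forall>\<^sub>F x in nhds (snd c p). x \<in> snd c ` fst c \<and> f (chart_inv c x) \<in> fst d"
    by eventually_elim (use hc in auto)
  \<comment> \<open>The \<open>C\<^sup>1\<close> instance of smoothness contains differentiability
    at every point of the coordinate domain.\<close>
  have "Ck_on (Suc 0) (snd c ` ?S) (snd d \<circ> f \<circ> chart_inv c)"
    using f c d unfolding smooth_map_def smooth_on_def by blast
  then have "(snd d \<circ> f \<circ> chart_inv c) differentiable (at (snd c p))"
    using p by simp
  then obtain D where "(snd d \<circ> f \<circ> chart_inv c has_derivative D) (at (snd c p))"
    unfolding differentiable_def ..
  then show thesis
    using that p hc hd ev by (simp add: has_chart_deriv_def)
qed

lemma has_chart_deriv_id:
  assumes "open_chart X c" "p \<in> fst c"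
  shows "has_chart_deriv c c (\<lambda>x. x) p (\<lambda>u. u)"
proof -
  note hc = assms(1)[unfolded open_chart_def]
  have "open (snd c ` fst c)" using hc by auto
  moreover have "snd c p \<in> snd c ` fst c" using assms by auto
  ultimately have ev: "\<forall>\<^sub>F x in nhds (snd c p). x \<in> snd c ` fst c"
    by (rule eventually_nhds_in_open)
  have "(snd c \<circ> (\<lambda>x. x) \<circ> chart_inv c has_derivative (\<lambda>u. u)) (at (snd c p))"
    by (rule has_derivative_transform_eventually[OF has_derivative_ident])
      (use ev assms hc in \<open>auto simp: eventually_at_filter f_inv_into_f elim!: eventually_mono\<close>)
  then show ?thesis
    using assms hc ev by (auto simp: has_chart_deriv_def inv_into_into elim!: eventually_mono)
qed

text \<open>Slices restrict a map on a product to one factor. Composed with multiplication they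
  produce the translations, and later the two partial derivatives of \<open>mu\<close>.\<close>

lemma has_chart_deriv_Pair_const:
  assumes "open_chart X c" "p \<in> fst c" "q \<in> fst d" "inj_on (snd d) (fst d)"
  shows "has_chart_deriv c (prod_chart c d) (\<lambda>x. (x, q)) p (\<lambda>u. (u, 0))"
    and "has_chart_deriv c (prod_chart d c) (\<lambda>x. (q, x)) p (\<lambda>u. (0, u))"
proof -
  note hc = assms(1)[unfolded open_chart_def]
  note id = has_chart_deriv_id[OF assms(1,2), unfolded has_chart_deriv_def]
  have ev: "\<forall>\<^sub>F x in nhds (snd c p). x \<in> snd c ` fst c \<and> chart_inv c x \<in> fst c"
    using id by simp
  have inj: "inj_on (map_prod (snd c) (snd d)) (fst c \<times> fst d)"
    "inj_on (map_prod (snd d) (snd c)) (fst d \<times> fst c)"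
    using hc assms(4) by (auto intro!: map_prod_inj_on)
  have "((\<lambda>x. (snd c (chart_inv c x), snd d q)) has_derivative (\<lambda>u. (u, 0))) (at (snd c p))"
    "((\<lambda>x. (snd d q, snd c (chart_inv c x))) has_derivative (\<lambda>u. (0, u))) (at (snd c p))"
    using id by (auto intro!: has_derivative_Pair simp: o_def)
  then show "has_chart_deriv c (prod_chart c d) (\<lambda>x. (x, q)) p (\<lambda>u. (u, 0))"
    "has_chart_deriv c (prod_chart d c) (\<lambda>x. (q, x)) p (\<lambda>u. (0, u))"
    using assms hc ev inj by (auto simp: has_chart_deriv_def o_def elim!: eventually_mono)
qed

section \<open>Tangent spaces\<close>

text \<open>The Jacobian of a change of charts at \<open>p\<close>, as it occurs in the
  compatibility condition of \<open>tangent_space\<close>.\<close>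

definition transition :: "'a \<Rightarrow> ('a, 'e::real_normed_vector) chart \<Rightarrow> ('a, 'e) chart \<Rightarrow> 'e \<Rightarrow> 'e" where
  "transition p c d = frechet_derivative (snd d \<circ> chart_inv c) (at (snd c p))"

context smooth_manifold
begin

lemma charts_at_ex: "p \<in> topspace (mtop M) \<Longrightarrow> \<exists>c. c \<in> charts_at M p"
  using charts_cover unfolding charts_at_def by blast

lemma atlas_subset: "c \<in> atlas M \<Longrightarrow> fst c \<subseteq> topspace (mtop M)"
  using charts_cover by blast

text \<open>Second countable spaces are Lindelof. Countability of the cover is what Sard's theorem
  will require.\<close>

lemma countable_subatlas:
  obtains C where "countable C" "C \<subseteq> atlas M" "topspace (mtop M) \<subseteq> (\<Union>c\<in>C. fst c)"
proof -
  have "Lindelof_space (mtop M)"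
    using second_countable by (rule second_countable_imp_Lindelof_space)
  then obtain V where V: "countable V" "V \<subseteq> fst ` atlas M" "\<Union>V = topspace (mtop M)"
    unfolding Lindelof_space_def using chart_open charts_cover
    by (metis (no_types, lifting) imageE)
  then obtain C where "countable C" "C \<subseteq> atlas M" "V = fst ` C"
    by (metis countable_subset_image)
  with V(3) that show thesis by blast
qed

text \<open>Chart compatibility is smoothness of the identity in coordinates; in this form the
  general results on smooth maps apply to transition maps.\<close>

lemma smooth_map_id: "smooth_map M M (\<lambda>x. x)"
  unfolding smooth_map_def
proof (intro conjI ballI)
  fix c d assume "c \<in> atlas M" "d \<in> atlas M"
  then show "smooth_on (snd c ` {x \<in> fst c. x \<in> fst d}) (snd d \<circ> (\<lambda>x. x) \<circ> chart_inv c)"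
    using charts_compatible[of c d] by (simp add: Int_def comp_def)
qed simp

lemma has_chart_deriv_transition:
  assumes "c \<in> charts_at M p" "d \<in> charts_at M p"
  shows "has_chart_deriv c d (\<lambda>x. x) p (transition p c d)"
proof -
  obtain D where D: "has_chart_deriv c d (\<lambda>x. x) p D"
    using smooth_map_has_chart_deriv[OF smooth_map_id, of c d p] assms
    by (auto simp: charts_at_def open_chart_atlas)
  then have "(snd d \<circ> chart_inv c has_derivative D) (at (snd c p))"
    by (simp add: has_chart_deriv_def o_def)
  then have "D = transition p c d"
    unfolding transition_def by (rule frechet_derivative_at)
  with D show ?thesis by simp
qed

text \<open>Chain rule for the identity read through the intermediate chart \<open>d\<close>, with
  uniqueness of derivatives.\<close>

lemma transition_cocycle:
  assumes "c \<in> charts_at M p" "d \<in> charts_at M p" "e \<in> charts_at M p"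
  shows "transition p d e (transition p c d w) = transition p c e w"
proof -
  have "has_chart_deriv c e ((\<lambda>x. x) \<circ> (\<lambda>x. x)) p (transition p d e \<circ> transition p c d)"
    using assms by (intro has_chart_deriv_chain[where d = d] has_chart_deriv_transition)
  then have "has_chart_deriv c e (\<lambda>x. x) p (transition p d e \<circ> transition p c d)"
    by (simp add: o_def)
  then have "transition p d e \<circ> transition p c d = transition p c e"
    using has_chart_deriv_transition[OF assms(1,3)] by (rule has_chart_deriv_unique)
  then show ?thesis by (simp add: fun_eq_iff)
qed

lemma transition_refl:
  assumes "c \<in> charts_at M p" shows "transition p c c w = w"
proof -
  have "has_chart_deriv c c (\<lambda>x. x) p (\<lambda>u. u)"
    using assms open_chart_atlas has_chart_deriv_id[of "mtop M" c p] by (auto simp: charts_at_def)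
  then have "(\<lambda>u. u) = transition p c c"
    using has_chart_deriv_transition[OF assms assms] by (rule has_chart_deriv_unique)
  then show ?thesis by (metis)
qed

lemma tangent_space_iff:
  "v \<in> tangent_space M p \<longleftrightarrow> (\<forall>c. c \<notin> charts_at M p \<longrightarrow> v c = 0) \<and>
     (\<forall>c\<in>charts_at M p. \<forall>d\<in>charts_at M p. v d = transition p c d (v c))"
  by (simp add: tangent_space_def transition_def)

lemma tangent_spaceD:
  "v \<in> tangent_space M p \<Longrightarrow> c \<in> charts_at M p \<Longrightarrow> d \<in> charts_at M p \<Longrightarrow> v d = transition p c d (v c)"
  "v \<in> tangent_space M p \<Longrightarrow> c \<notin> charts_at M p \<Longrightarrow> v c = 0"
  unfolding tangent_space_iff by blast+

lemma subspace_tangent_space: "subspace (tangent_space M p)"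
proof (rule subspaceI)
  note lin = has_chart_deriv_transition[THEN has_chart_deriv_linear]
  show "0 \<in> tangent_space M p"
    by (auto simp: tangent_space_iff linear_0[OF lin])
  show "v + w \<in> tangent_space M p" if v: "v \<in> tangent_space M p" and w: "w \<in> tangent_space M p" for v w
    unfolding tangent_space_iff
  proof (intro conjI ballI allI impI)
    fix c d assume "c \<in> charts_at M p" "d \<in> charts_at M p"
    then show "(v + w) d = transition p c d ((v + w) c)"
      using tangent_spaceD(1)[OF v, of c d] tangent_spaceD(1)[OF w, of c d]
      by (simp add: linear_add[OF lin])
  qed (simp add: tangent_spaceD(2)[OF v] tangent_spaceD(2)[OF w])
  show "r *\<^sub>R v \<in> tangent_space M p" if v: "v \<in> tangent_space M p" for r v
    unfolding tangent_space_iff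
  proof (intro conjI ballI allI impI)
    fix c d assume "c \<in> charts_at M p" "d \<in> charts_at M p"
    then show "(r *\<^sub>R v) d = transition p c d ((r *\<^sub>R v) c)"
      using tangent_spaceD(1)[OF v, of c d] by (simp add: scaleR_fun_def linear_scale[OF lin])
  qed (simp add: scaleR_fun_def tangent_spaceD(2)[OF v])
qed

lemma tangent_vector_eqI:
  assumes v: "v \<in> tangent_space M p" and w: "w \<in> tangent_space M p"
    and c: "c \<in> charts_at M p" "v c = w c"
  shows "v = w"
proof
  fix d
  show "v d = w d"
  proof (cases "d \<in> charts_at M p")
    case True
    show ?thesis
      unfolding tangent_spaceD(1)[OF v c(1) True] tangent_spaceD(1)[OF w c(1) True] c(2) ..
  qed (simp add: tangent_spaceD(2)[OF v] tangent_spaceD(2)[OF w])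
qed

text \<open>The value \<open>w\<close> is spread to all other charts by the transition maps, and the
  cocycle identity makes the result compatible. With \<open>tangent_vector_eqI\<close>, evaluation
  at one chart identifies the tangent space with the model space.\<close>

lemma tangent_vector_ex:
  assumes c: "c \<in> charts_at M p"
  obtains v where "v \<in> tangent_space M p" "v c = w"
proof
  let ?v = "\<lambda>d. if d \<in> charts_at M p then transition p c d w else 0"
  show "?v \<in> tangent_space M p"
    unfolding tangent_space_iff using transition_cocycle[OF c] by simp
  show "?v c = w" using c by (simp add: transition_refl)
qed

end

section \<open>Differentials of smooth maps\<close>

lemma differential_eq:
  assumes "has_chart_deriv (SOME c. c \<in> charts_at M p) d f p D" "d \<in> charts_at N (f p)"
  shows "differential M N f p v d = D (v (SOME c. c \<in> charts_at M p))"
  using assms frechet_derivative_at[of _ D]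
  by (simp add: differential_def has_chart_deriv_def)

locale smooth_map_at = M: smooth_manifold M + N: smooth_manifold N
  for M :: "('a, 'e::real_normed_vector) manifold" and N :: "('b, 'f::real_normed_vector) manifold" +
  fixes f and p
  assumes smooth: "smooth_map M N f" and pt: "p \<in> topspace (mtop M)"
begin

text \<open>This is the very chart that \<open>differential\<close> selects by \<open>SOME\<close>,
  so differentials are computed without comparing different choices of source chart.\<close>

definition "base_chart = (SOME c. c \<in> charts_at M p)"

lemma base_chart: "base_chart \<in> charts_at M p"
  unfolding base_chart_def by (rule someI_ex[OF M.charts_at_ex[OF pt]])

lemma deriv_ex:
  assumes "d \<in> charts_at N (f p)"
  shows "\<exists>D. has_chart_deriv base_chart d f p D \<and> (\<forall>v. differential M N f p v d = D (v base_chart))"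
proof -
  obtain D where "has_chart_deriv base_chart d f p D"
    using smooth_map_has_chart_deriv[OF smooth, of base_chart d p] assms base_chart
    by (auto simp: charts_at_def M.open_chart_atlas N.open_chart_atlas)
  then show ?thesis
    using assms differential_eq[of M p d f D N, folded base_chart_def] by blast
qed

lemma linear_differential: "linear (differential M N f p)"
proof
  fix v w and r :: real
  have "differential M N f p (v + w) d = differential M N f p v d + differential M N f p w d"
    "differential M N f p (r *\<^sub>R v) d = r *\<^sub>R differential M N f p v d" for d
  proof -
    have "differential M N f p (v + w) d = differential M N f p v d + differential M N f p w d \<and>
      differential M N f p (r *\<^sub>R v) d = r *\<^sub>R differential M N f p v d"
    proof (cases "d \<in> charts_at N (f p)")
      case True
      then obtain D where D: "has_chart_deriv base_chart d f p D"
        "\<And>v. differential M N f p v d = D (v base_chart)" using deriv_ex by blast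
      show ?thesis
        using has_chart_deriv_linear[OF D(1)]
        by (simp add: D(2) scaleR_fun_def linear_add linear_scale)
    qed (simp add: differential_def)
    then show "differential M N f p (v + w) d = differential M N f p v d + differential M N f p w d"
      "differential M N f p (r *\<^sub>R v) d = r *\<^sub>R differential M N f p v d" by auto
  qed
  then show "differential M N f p (v + w) = differential M N f p v + differential M N f p w"
    "differential M N f p (r *\<^sub>R v) = r *\<^sub>R differential M N f p v"
    by (auto simp: scaleR_fun_def)
qed

text \<open>The values in two target charts \<open>d\<close> and \<open>e\<close> come from the same
  vector \<open>v base_chart\<close>, and the chain rule relates the two derivatives by the
  transition map.\<close>

lemma differential_in_tangent_space: "differential M N f p v \<in> tangent_space N (f p)"
  unfolding N.tangent_space_iff
proof (intro conjI ballI allI impI)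
  fix d e assume d: "d \<in> charts_at N (f p)" and e: "e \<in> charts_at N (f p)"
  obtain D where D: "has_chart_deriv base_chart d f p D"
    "differential M N f p v d = D (v base_chart)" using deriv_ex[OF d] by blast
  obtain E where E: "has_chart_deriv base_chart e f p E"
    "differential M N f p v e = E (v base_chart)" using deriv_ex[OF e] by blast
  have "has_chart_deriv base_chart e ((\<lambda>x. x) \<circ> f) p (transition (f p) d e \<circ> D)"
    by (rule has_chart_deriv_chain[OF D(1) N.has_chart_deriv_transition[OF d e]])
  then have "E = transition (f p) d e \<circ> D"
    using E(1) by (auto simp: o_def[of _ f] intro: has_chart_deriv_unique)
  then show "differential M N f p v e = transition (f p) d e (differential M N f p v d)"
    by (simp add: D E)
qed (simp add: differential_def)

end

section \<open>Lie groups\<close>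

context lie_group
begin

lemma mult_has_chart_deriv:
  assumes "c \<in> atlas M" "d \<in> atlas M" "e \<in> atlas M" "x \<in> fst c" "y \<in> fst d" "x \<otimes> y \<in> fst e"
  shows "\<exists>D. has_chart_deriv (prod_chart c d) e (\<lambda>(x, y). x \<otimes> y) (x, y) D"
proof -
  have "prod_chart c d \<in> atlas (product_manifold M M)"
    using assms unfolding product_manifold_def by fastforce
  moreover have "open_chart (mtop (product_manifold M M)) (prod_chart c d)"
    using assms by (simp add: product_manifold_def open_chart_prod_chart open_chart_atlas)
  moreover have "open_chart (mtop M) e" using assms by (simp add: open_chart_atlas)
  moreover have "(x, y) \<in> fst (prod_chart c d)" "(case (x, y) of (x, y) \<Rightarrow> x \<otimes> y) \<in> fst e"
    using assms by auto
  ultimately show ?thesis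
    using smooth_map_has_chart_deriv[OF smooth_mult] assms(3) by metis
qed

text \<open>A translation is a slice through \<open>g\<close> followed by multiplication;
  \<open>d\<close> serves as a chart around \<open>g\<close> to form the product chart.\<close>

lemma translation_has_chart_deriv:
  assumes "g \<in> carrier G" "c \<in> atlas M" "e \<in> atlas M" "p \<in> fst c"
  shows "g \<otimes> p \<in> fst e \<Longrightarrow> \<exists>D. has_chart_deriv c e (\<lambda>x. g \<otimes> x) p D"
    and "p \<otimes> g \<in> fst e \<Longrightarrow> \<exists>D. has_chart_deriv c e (\<lambda>x. x \<otimes> g) p D"
proof -
  obtain d where d: "d \<in> atlas M" "g \<in> fst d"
    using assms(1) charts_at_ex[of g] topspace_eq_carrier by (auto simp: charts_at_def)
  note Pair = has_chart_deriv_Pair_const[OF open_chart_atlas[OF assms(2)] assms(4) d(2)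
      open_chart_atlas[OF d(1), unfolded open_chart_def, THEN conjunct2, THEN conjunct1]]
  show "\<exists>D. has_chart_deriv c e (\<lambda>x. g \<otimes> x) p D" if gp: "g \<otimes> p \<in> fst e"
  proof -
    obtain D where "has_chart_deriv (prod_chart d c) e (\<lambda>(x, y). x \<otimes> y) (g, p) D"
      using mult_has_chart_deriv[OF d(1) assms(2,3) d(2) assms(4)] gp by blast
    then show ?thesis
      using has_chart_deriv_chain[OF Pair(2), of e "\<lambda>(x, y). x \<otimes> y" D] by (auto simp: o_def)
  qed
  show "\<exists>D. has_chart_deriv c e (\<lambda>x. x \<otimes> g) p D" if gp: "p \<otimes> g \<in> fst e"
  proof -
    obtain D where "has_chart_deriv (prod_chart c d) e (\<lambda>(x, y). x \<otimes> y) (p, g) D"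
      using mult_has_chart_deriv[OF assms(2) d(1) assms(3,4) d(2)] gp by blast
    then show ?thesis
      using has_chart_deriv_chain[OF Pair(1), of e "\<lambda>(x, y). x \<otimes> y" D] by (auto simp: o_def)
  qed
qed

end

section \<open>Zappa-Szep products\<close>

locale zappa_szep_lie_groups = lie_group G M
  for G :: "('a, 'm) monoid_scheme" (structure)
    and M :: "('a, 'e::real_normed_vector) manifold" +
  fixes H K :: "'a set"
    and N\<^sub>H :: "('a, 'f::real_normed_vector) manifold"
    and N\<^sub>K :: "('a, 'g::real_normed_vector) manifold"
  assumes lie_subgroup_H: "lie_subgroup G M H N\<^sub>H"
    and lie_subgroup_K: "lie_subgroup G M K N\<^sub>K"
    and factorization: "zappa_szep_product G H K"
begin

sublocale H: lie_group "G\<lparr>carrier := H\<rparr>" N\<^sub>H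
  using lie_subgroup_H by (simp add: lie_subgroup_def)

sublocale K: lie_group "G\<lparr>carrier := K\<rparr>" N\<^sub>K
  using lie_subgroup_K by (simp add: lie_subgroup_def)

lemma subgroups: "subgroup H G" "subgroup K G"
  using factorization by (simp_all add: zappa_szep_product_def)

lemma topspaces: "topspace (mtop N\<^sub>H) = H" "topspace (mtop N\<^sub>K) = K"
  using H.topspace_eq_carrier K.topspace_eq_carrier by simp_all

lemma smooth_inclusions: "smooth_map N\<^sub>H M (\<lambda>x. x)" "smooth_map N\<^sub>K M (\<lambda>x. x)"
  using lie_subgroup_H lie_subgroup_K by (simp_all add: lie_subgroup_def immersion_def)

lemma charts_carrier:
  "c \<in> atlas N\<^sub>H \<Longrightarrow> x \<in> fst c \<Longrightarrow> x \<in> H" "d \<in> atlas N\<^sub>K \<Longrightarrow> y \<in> fst d \<Longrightarrow> y \<in> K"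
  using H.atlas_subset K.atlas_subset topspaces by blast+

lemma carriers: "x \<in> H \<Longrightarrow> x \<in> carrier G" "y \<in> K \<Longrightarrow> y \<in> carrier G"
  using subgroups subgroup.subset by blast+

lemma charts_at_carrier: "x \<in> carrier G \<Longrightarrow> \<exists>c. c \<in> atlas M \<and> x \<in> fst c"
  using charts_at_ex topspace_eq_carrier by (simp add: charts_at_def)

section \<open>The multiplication map and its derivatives\<close>

definition mu :: "'a \<times> 'a \<Rightarrow> 'a" where "mu = (\<lambda>(x, y). x \<otimes> y)"

lemma mu_Pair: "mu (x, y) = x \<otimes> y" by (simp add: mu_def)

text \<open>With respect to the manifold structures of \<open>H\<close> and \<open>K\<close>
  themselves, \<open>mu\<close> is the product of the two inclusions followed by multiplication in
  \<open>G\<close>; the charts \<open>c'\<close> and \<open>d'\<close> of \<open>M\<close> mediate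
  between them.\<close>

lemma mu_has_chart_deriv:
  assumes c: "c \<in> atlas N\<^sub>H" "x \<in> fst c" and d: "d \<in> atlas N\<^sub>K" "y \<in> fst d"
    and e: "e \<in> atlas M" "x \<otimes> y \<in> fst e"
  shows "\<exists>D. has_chart_deriv (prod_chart c d) e mu (x, y) D"
proof -
  obtain c' where c': "c' \<in> atlas M" "x \<in> fst c'"
    using charts_at_carrier[OF carriers(1)[OF charts_carrier(1)[OF c]]] by blast
  obtain d' where d': "d' \<in> atlas M" "y \<in> fst d'"
    using charts_at_carrier[OF carriers(2)[OF charts_carrier(2)[OF d]]] by blast
  obtain D1 where D1: "has_chart_deriv c c' (\<lambda>x. x) x D1"
    using smooth_map_has_chart_deriv[OF smooth_inclusions(1) c(1) H.open_chart_atlas[OF c(1)]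
      c'(1) open_chart_atlas[OF c'(1)] c(2) c'(2)] by blast
  obtain D2 where D2: "has_chart_deriv d d' (\<lambda>x. x) y D2"
    using smooth_map_has_chart_deriv[OF smooth_inclusions(2) d(1) K.open_chart_atlas[OF d(1)]
      d'(1) open_chart_atlas[OF d'(1)] d(2) d'(2)] by blast
  obtain D3 where D3: "has_chart_deriv (prod_chart c' d') e mu (x, y) D3"
    using mult_has_chart_deriv[OF c'(1) d'(1) e(1) c'(2) d'(2) e(2)] unfolding mu_def by blast
  have "has_chart_deriv (prod_chart c d) e (mu \<circ> map_prod (\<lambda>x. x) (\<lambda>x. x)) (x, y) (D3 \<circ> map_prod D1 D2)"
    by (rule has_chart_deriv_chain[OF has_chart_deriv_map_prod[OF D1 D2]]) (use D3 in simp)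
  then have "has_chart_deriv (prod_chart c d) e mu (x, y) (D3 \<circ> map_prod D1 D2)"
    by (rule has_chart_deriv_cong) auto
  then show ?thesis by blast
qed

text \<open>\<open>T\<close> is the derivative of the translations by \<open>inv a\<close> in
  \<open>H\<close> and by \<open>inv b\<close> in \<open>K\<close>; \<open>L\<close> is that of the
  translations by \<open>a\<close> and \<open>b\<close> in \<open>G\<close>. As \<open>L\<close>
  maps the model space of \<open>G\<close> to itself, surjectivity of \<open>L\<close> will imply
  injectivity.\<close>

lemma mu_deriv_factors:
  assumes 0: "c\<^sub>0 \<in> atlas N\<^sub>H" "d\<^sub>0 \<in> atlas N\<^sub>K" "e\<^sub>0 \<in> atlas M"
    and D\<^sub>0: "has_chart_deriv (prod_chart c\<^sub>0 d\<^sub>0) e\<^sub>0 mu (\<one>, \<one>) D\<^sub>0"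
    and c: "c \<in> atlas N\<^sub>H" and d: "d \<in> atlas N\<^sub>K" and e: "e \<in> atlas M"
    and D: "has_chart_deriv (prod_chart c d) e mu (a, b) D"
  shows "\<exists>L T. linear L \<and> D = L \<circ> D\<^sub>0 \<circ> T"
proof -
  have one: "\<one> \<in> fst c\<^sub>0" "\<one> \<in> fst d\<^sub>0" "\<one> \<in> fst e\<^sub>0"
    using D\<^sub>0 by (auto simp: has_chart_deriv_def mu_Pair)
  have ab: "a \<in> fst c" "b \<in> fst d" "a \<otimes> b \<in> fst e"
    using D by (auto simp: has_chart_deriv_def mu_Pair)
  have aH: "a \<in> H" and bK: "b \<in> K" using charts_carrier c d ab by blast+
  have G: "a \<in> carrier G" "b \<in> carrier G" using aH bK carriers by blast+
  have inv: "inv a \<in> H" "inv b \<in> K"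
    using aH bK subgroups by (auto intro: subgroup.m_inv_closed)
  \<comment> \<open>The point runs from \<open>(a, b)\<close> to \<open>(\<one>, \<one>)\<close>,
    then to \<open>\<one>\<close>, to \<open>a\<close> and to \<open>a \<otimes> b\<close>;
    \<open>e'\<close> is the chart for the stop at \<open>a\<close>.\<close>
  obtain e' where e': "e' \<in> atlas M" "a \<in> fst e'" using charts_at_carrier[OF G(1)] by blast
  obtain T1 where T1: "has_chart_deriv c c\<^sub>0 (\<lambda>x. inv a \<otimes> x) a T1"
    using H.translation_has_chart_deriv(1)[of "inv a" c c\<^sub>0 a] inv c 0 ab one G by auto
  obtain T2 where T2: "has_chart_deriv d d\<^sub>0 (\<lambda>x. x \<otimes> inv b) b T2"
    using K.translation_has_chart_deriv(2)[of "inv b" d d\<^sub>0 b] inv d 0 ab one G by auto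
  obtain L1 where L1: "has_chart_deriv e\<^sub>0 e' (\<lambda>x. a \<otimes> x) \<one> L1"
    using translation_has_chart_deriv(1)[of a e\<^sub>0 e' \<one>] G e' 0 one by auto
  obtain L2 where L2: "has_chart_deriv e' e (\<lambda>x. x \<otimes> b) a L2"
    using translation_has_chart_deriv(2)[of b e' e a] G e' e ab by auto
  have 1: "has_chart_deriv (prod_chart c d) e\<^sub>0 (mu \<circ> map_prod (\<lambda>x. inv a \<otimes> x) (\<lambda>x. x \<otimes> inv b))
      (a, b) (D\<^sub>0 \<circ> map_prod T1 T2)"
    by (rule has_chart_deriv_chain[OF has_chart_deriv_map_prod[OF T1 T2]]) (use D\<^sub>0 G in simp)
  have 2: "has_chart_deriv (prod_chart c d) e'
      ((\<lambda>x. a \<otimes> x) \<circ> (mu \<circ> map_prod (\<lambda>x. inv a \<otimes> x) (\<lambda>x. x \<otimes> inv b)))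
      (a, b) (L1 \<circ> (D\<^sub>0 \<circ> map_prod T1 T2))"
    by (rule has_chart_deriv_chain[OF 1]) (use L1 G in \<open>simp add: mu_Pair\<close>)
  have "has_chart_deriv (prod_chart c d) e
      ((\<lambda>x. x \<otimes> b) \<circ> ((\<lambda>x. a \<otimes> x) \<circ> (mu \<circ> map_prod (\<lambda>x. inv a \<otimes> x) (\<lambda>x. x \<otimes> inv b))))
      (a, b) (L2 \<circ> (L1 \<circ> (D\<^sub>0 \<circ> map_prod T1 T2)))"
    by (rule has_chart_deriv_chain[OF 2]) (use L2 G in \<open>simp add: mu_Pair\<close>)
  then have "has_chart_deriv (prod_chart c d) e mu (a, b) (L2 \<circ> (L1 \<circ> (D\<^sub>0 \<circ> map_prod T1 T2)))"
  proof (rule has_chart_deriv_cong)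
    fix z assume "z \<in> fst (prod_chart c d)"
    then obtain x y where z: "z = (x, y)" and xy: "x \<in> carrier G" "y \<in> carrier G"
      using charts_carrier c d carriers by (cases z) auto
    have "a \<otimes> ((inv a \<otimes> x) \<otimes> (y \<otimes> inv b)) = (x \<otimes> y) \<otimes> inv b"
      using G xy by (simp add: m_assoc[symmetric])
    then have "a \<otimes> ((inv a \<otimes> x) \<otimes> (y \<otimes> inv b)) \<otimes> b = x \<otimes> y"
      using G xy by (simp add: m_assoc)
    then show "((\<lambda>x. x \<otimes> b) \<circ> ((\<lambda>x. a \<otimes> x) \<circ> (mu \<circ> map_prod (\<lambda>x. inv a \<otimes> x) (\<lambda>x. x \<otimes> inv b)))) z = mu z"
      by (simp add: z mu_Pair)
  qed
  then have "D = (L2 \<circ> L1) \<circ> D\<^sub>0 \<circ> map_prod T1 T2"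
    using D by (auto simp: o_assoc intro: has_chart_deriv_unique)
  moreover have "linear (L2 \<circ> L1)"
    using L1 L2 by (intro linear_compose has_chart_deriv_linear)
  ultimately show ?thesis by blast
qed

text \<open>If \<open>D = L \<circ> D\<^sub>0 \<circ> T\<close> is onto, then \<open>L\<close> is
  onto, hence injective as an endomorphism of a finite-dimensional space. Cancelling it shows that
  \<open>D\<^sub>0\<close> is onto.\<close>

lemma mu_deriv_not_surj:
  assumes 0: "c\<^sub>0 \<in> atlas N\<^sub>H" "d\<^sub>0 \<in> atlas N\<^sub>K" "e\<^sub>0 \<in> atlas M"
    and D\<^sub>0: "has_chart_deriv (prod_chart c\<^sub>0 d\<^sub>0) e\<^sub>0 mu (\<one>, \<one>) D\<^sub>0" "\<not> surj D\<^sub>0"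
    and cde: "c \<in> atlas N\<^sub>H" "d \<in> atlas N\<^sub>K" "e \<in> atlas M"
    and D: "has_chart_deriv (prod_chart c d) e mu (a, b) D"
  shows "\<not> surj D"
proof
  assume s: "surj D"
  obtain L T where LT: "linear L" "D = L \<circ> D\<^sub>0 \<circ> T"
    using mu_deriv_factors[OF 0 D\<^sub>0(1) cde D] by blast
  have "surj L" using s unfolding LT(2) surj_def by (metis comp_apply)
  then have "inj L"
    using surj_linear_imp_inj[OF finite_dim_model order_refl LT(1)] by blast
  have "surj D\<^sub>0"
  proof -
    have "\<exists>x. w = D\<^sub>0 x" for w
    proof -
      obtain y where "L w = L (D\<^sub>0 (T y))" using s unfolding LT(2) surj_def by (metis comp_apply)
      then show ?thesis using \<open>inj L\<close> by (metis injD)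
    qed
    then show ?thesis by (simp add: surj_def)
  qed
  with D\<^sub>0(2) show False ..
qed

text \<open>If \<open>h \<otimes> k = h' \<otimes> k'\<close>, then
  \<open>inv h' \<otimes> h = k' \<otimes> inv k\<close> lies in both subgroups and is therefore
  \<open>\<one>\<close>.\<close>

lemma inj_on_mu: "inj_on mu (H \<times> K)"
proof (rule inj_onI, clarify)
  fix h k h' k' assume h: "h \<in> H" "h' \<in> H" and k: "k \<in> K" "k' \<in> K" and "mu (h, k) = mu (h', k')"
  then have eq: "h \<otimes> k = h' \<otimes> k'" by (simp add: mu_Pair)
  have G: "h \<in> carrier G" "h' \<in> carrier G" "k \<in> carrier G" "k' \<in> carrier G"
    using h k carriers by blast+
  have "inv h' \<otimes> h = inv h' \<otimes> (h \<otimes> k) \<otimes> inv k"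
    using G by (simp add: m_assoc)
  also have "\<dots> = k' \<otimes> inv k"
    using G unfolding eq by (simp add: m_assoc[symmetric])
  finally have *: "inv h' \<otimes> h = k' \<otimes> inv k" .
  have "inv h' \<otimes> h \<in> H" "k' \<otimes> inv k \<in> K"
    using h k subgroups by (simp_all add: subgroup.m_closed subgroup.m_inv_closed)
  then have 1: "inv h' \<otimes> h = \<one>" "k' \<otimes> inv k = \<one>"
    using factorization unfolding zappa_szep_product_def * by blast+
  have "h = h' \<otimes> (inv h' \<otimes> h)" using G by (simp add: m_assoc[symmetric])
  moreover have "k' = (k' \<otimes> inv k) \<otimes> k" using G by (simp add: m_assoc)
  ultimately show "h = h' \<and> k = k'" unfolding 1 using G by simp
qed

text \<open>In charts around \<open>\<one>\<close>, \<open>mu\<close> is a continuous injection of a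
  nonempty open subset of the product of the model spaces of \<open>H\<close> and \<open>K\<close>
  into the model space of \<open>G\<close>, so invariance of dimension applies.\<close>

lemma dim_le:
  "dim (UNIV :: (('f \<times> 'g) \<times> real) set) \<le> dim (UNIV :: ('e \<times> real) set)"
proof -
  obtain c where c: "c \<in> atlas N\<^sub>H" "\<one> \<in> fst c"
    using H.charts_at_ex[of \<one>] topspaces subgroups by (auto simp: charts_at_def subgroup.one_closed)
  obtain d where d: "d \<in> atlas N\<^sub>K" "\<one> \<in> fst d"
    using K.charts_at_ex[of \<one>] topspaces subgroups by (auto simp: charts_at_def subgroup.one_closed)
  obtain e where e: "e \<in> atlas M" "\<one> \<in> fst e" using charts_at_carrier[of \<one>] by auto
  let ?i = "chart_inv (prod_chart c d)"
  let ?F = "snd e \<circ> mu \<circ> ?i"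
  obtain D where D: "has_chart_deriv (prod_chart c d) e mu (\<one>, \<one>) D"
    using mu_has_chart_deriv[OF c d e(1)] e(2) by auto
  then obtain U where U: "open U" "snd (prod_chart c d) (\<one>, \<one>) \<in> U"
    "\<And>z. z \<in> U \<Longrightarrow> z \<in> snd (prod_chart c d) ` fst (prod_chart c d) \<and> mu (?i z) \<in> fst e"
    unfolding has_chart_deriv_def eventually_nhds by metis
  have i: "?i z \<in> fst (prod_chart c d)" "snd (prod_chart c d) (?i z) = z" if "z \<in> U" for z
    using U(3)[OF that] inv_into_into[of z "snd (prod_chart c d)" "fst (prod_chart c d)"]
      f_inv_into_f[of z "snd (prod_chart c d)" "fst (prod_chart c d)"] by blast+
  show ?thesis
  proof (rule dim_le_of_injective[OF finite_dim_prod[OF H.finite_dim_model K.finite_dim_model] finite_dim_model U(1)])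
    show "U \<noteq> {}" using U(2) by blast
    \<comment> \<open>Every point of \<open>U\<close> represents a pair \<open>(a, b)\<close> at
      which \<open>mu\<close> is differentiable in the same three charts, which gives continuity on
      all of \<open>U\<close>.\<close>
    show "continuous_on U ?F"
    proof (rule continuous_at_imp_continuous_on, rule ballI)
      fix z assume z: "z \<in> U"
      obtain a b where ab: "?i z = (a, b)" by (cases "?i z")
      have "a \<in> fst c" "b \<in> fst d" "a \<otimes> b \<in> fst e"
        using i(1)[OF z] U(3)[OF z] unfolding ab by (auto simp: mu_Pair)
      then obtain E where E: "has_chart_deriv (prod_chart c d) e mu (a, b) E"
        using mu_has_chart_deriv[OF c(1) _ d(1) _ e(1)] by blast
      moreover have "snd (prod_chart c d) (a, b) = z" using i(2)[OF z] unfolding ab .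
      ultimately have "(?F has_derivative E) (at z)" unfolding has_chart_deriv_def by metis
      then show "isCont ?F z" by (rule has_derivative_continuous)
    qed
    show "inj_on ?F U"
    proof (rule inj_onI)
      fix z w assume z: "z \<in> U" and w: "w \<in> U" and "?F z = ?F w"
      moreover have "inj_on (snd e) (fst e)"
        using open_chart_atlas[OF e(1)] by (simp add: open_chart_def)
      ultimately have "mu (?i z) = mu (?i w)"
        using U(3)[OF z] U(3)[OF w] unfolding inj_on_def by (metis comp_apply)
      moreover have "fst (prod_chart c d) \<subseteq> H \<times> K"
        using charts_carrier(1)[OF c(1)] charts_carrier(2)[OF d(1)] by auto
      ultimately have "?i z = ?i w"
        using inj_onD[OF inj_on_mu] i(1)[OF z] i(1)[OF w] by blast
      then show "z = w" using i(2)[OF z] i(2)[OF w] by metis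
    qed
  qed
qed

lemma mu_deriv_surj:
  assumes 0: "c\<^sub>0 \<in> atlas N\<^sub>H" "d\<^sub>0 \<in> atlas N\<^sub>K" "e\<^sub>0 \<in> atlas M"
    and D\<^sub>0: "has_chart_deriv (prod_chart c\<^sub>0 d\<^sub>0) e\<^sub>0 mu (\<one>, \<one>) D\<^sub>0"
  shows "surj D\<^sub>0"
proof (rule ccontr)
  assume nsurj: "\<not> surj D\<^sub>0"
  obtain C where C: "countable C" "C \<subseteq> atlas N\<^sub>H" "H \<subseteq> (\<Union>c\<in>C. fst c)"
    by (rule H.countable_subatlas) (simp add: topspaces)
  obtain C' where C': "countable C'" "C' \<subseteq> atlas N\<^sub>K" "K \<subseteq> (\<Union>c\<in>C'. fst c)"
    by (rule K.countable_subatlas) (simp add: topspaces)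
  \<comment> \<open>\<open>f i\<close> is \<open>mu\<close> in the product chart \<open>i\<close>,
    and \<open>S i\<close> is the set of coordinates whose product falls into the target chart
    \<open>e\<^sub>0\<close>; elsewhere \<open>f i\<close> has no meaning.\<close>
  define f where "f i = snd e\<^sub>0 \<circ> mu \<circ> chart_inv (prod_chart (fst i) (snd i))"
    for i :: "('a, 'f) chart \<times> ('a, 'g) chart"
  define S where "S i = snd (prod_chart (fst i) (snd i)) `
    {z \<in> fst (prod_chart (fst i) (snd i)). mu z \<in> fst e\<^sub>0}"
    for i :: "('a, 'f) chart \<times> ('a, 'g) chart"
  have inj: "inj_on (snd (prod_chart (fst i) (snd i))) (fst (prod_chart (fst i) (snd i)))"
    if i: "i \<in> C \<times> C'" for i
  proof -
    have "fst i \<in> atlas N\<^sub>H" "snd i \<in> atlas N\<^sub>K" using i C C' by auto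
    then show ?thesis
      using open_chart_prod_chart[OF H.open_chart_atlas K.open_chart_atlas]
      unfolding open_chart_def by blast
  qed
  \<comment> \<open>One target chart suffices: its image is open and contains the image of
    \<open>\<one>\<close>, yet it would consist of critical values only.\<close>
  have "snd e\<^sub>0 ` fst e\<^sub>0 = {}"
  proof (rule open_subset_critical_values_empty[where f = f and S = S, OF
        finite_dim_prod[OF H.finite_dim_model K.finite_dim_model] finite_dim_model dim_le])
    show "countable (C \<times> C')" using C C' by simp
    show "open (snd e\<^sub>0 ` fst e\<^sub>0)" using chart_open_image 0 by blast
  next
    fix i z assume i: "i \<in> C \<times> C'" and "z \<in> S i"
    then obtain a b where ab: "a \<in> fst (fst i)" "b \<in> fst (snd i)" "a \<otimes> b \<in> fst e\<^sub>0"
      "z = snd (prod_chart (fst i) (snd i)) (a, b)"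
      by (auto simp: S_def mu_Pair)
    have cd: "fst i \<in> atlas N\<^sub>H" "snd i \<in> atlas N\<^sub>K" using i C C' by auto
    obtain D where D: "has_chart_deriv (prod_chart (fst i) (snd i)) e\<^sub>0 mu (a, b) D"
      using mu_has_chart_deriv[OF cd(1) ab(1) cd(2) ab(2) 0(3) ab(3)] by blast
    then have "(f i has_derivative D) (at z)"
      unfolding ab(4) f_def has_chart_deriv_def by blast
    then show "\<exists>D. (f i has_derivative D) (at z) \<and> \<not> surj D"
      using mu_deriv_not_surj[OF 0 D\<^sub>0 nsurj cd 0(3) D] by blast
  next
    show "snd e\<^sub>0 ` fst e\<^sub>0 \<subseteq> (\<Union>i\<in>C \<times> C'. f i ` S i)"
    proof clarify
      fix g assume g: "g \<in> fst e\<^sub>0"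
      \<comment> \<open>Here \<open>G = HK\<close> enters: the factors of \<open>g\<close> lie in
        charts of the countable covers, so every point of the chart image is a value of some
        \<open>f i\<close> on \<open>S i\<close>.\<close>
      then have "g \<in> H <#> K"
        using factorization atlas_subset[OF 0(3)] topspace_eq_carrier
        unfolding zappa_szep_product_def by auto
      then obtain h k where hk: "h \<in> H" "k \<in> K" "g = h \<otimes> k"
        unfolding set_mult_def by blast
      then obtain c d where cd: "c \<in> C" "h \<in> fst c" "d \<in> C'" "k \<in> fst d"
        using C C' by blast
      let ?z = "snd (prod_chart c d) (h, k)"
      have i: "(c, d) \<in> C \<times> C'" using cd by simp
      have "?z \<in> S (c, d)" using cd g hk by (auto simp: S_def mu_Pair)
      moreover have "snd e\<^sub>0 g = f (c, d) ?z"
        using inv_into_f_f[OF inj[OF i], of "(h, k)"] cd hk by (simp add: f_def mu_Pair)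
      ultimately show "snd e\<^sub>0 g \<in> (\<Union>i\<in>C \<times> C'. f i ` S i)" using i by blast
    qed
  qed
  moreover have "\<one> \<in> fst e\<^sub>0" using D\<^sub>0 by (simp add: has_chart_deriv_def mu_Pair)
  ultimately show False by blast
qed

text \<open>A surjective linear map onto a space of at least the same dimension is injective;
  \<open>dim_le\<close> supplies the inequality.\<close>

lemma mu_deriv_inj:
  assumes 0: "c\<^sub>0 \<in> atlas N\<^sub>H" "d\<^sub>0 \<in> atlas N\<^sub>K" "e\<^sub>0 \<in> atlas M"
    and D\<^sub>0: "has_chart_deriv (prod_chart c\<^sub>0 d\<^sub>0) e\<^sub>0 mu (\<one>, \<one>) D\<^sub>0"
  shows "inj D\<^sub>0"
  using surj_linear_imp_inj_prod_real[OF finite_dim_prod[OF H.finite_dim_model K.finite_dim_model] dim_le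
      has_chart_deriv_linear[OF D\<^sub>0] mu_deriv_surj[OF assms]] .

section \<open>Direct sum of the tangent spaces at the identity\<close>

sublocale inclusion_H: smooth_map_at N\<^sub>H M "\<lambda>x. x" \<one>
  using smooth_inclusions topspaces subgroups by unfold_locales (simp_all add: subgroup.one_closed)

sublocale inclusion_K: smooth_map_at N\<^sub>K M "\<lambda>x. x" \<one>
  using smooth_inclusions topspaces subgroups by unfold_locales (simp_all add: subgroup.one_closed)

abbreviation "d\<^sub>H \<equiv> differential N\<^sub>H M (\<lambda>x. x) \<one>"
abbreviation "d\<^sub>K \<equiv> differential N\<^sub>K M (\<lambda>x. x) \<one>"

text \<open>Read in a chart \<open>e\<close>, the sum \<open>d\<^sub>H v + d\<^sub>K w\<close> is
  the derivative \<open>D\<close> of \<open>mu\<close> applied to the coordinates of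
  \<open>v\<close> and \<open>w\<close>. Surjectivity of \<open>D\<close> gives spanning,
  injectivity gives trivial intersection.\<close>

lemma tangent_spaces_direct_sum:
  "is_direct_sum (tangent_space M \<one>) (d\<^sub>H ` tangent_space N\<^sub>H \<one>) (d\<^sub>K ` tangent_space N\<^sub>K \<one>)"
proof -
  \<comment> \<open>These are the charts in which \<open>d\<^sub>H\<close> and
    \<open>d\<^sub>K\<close> evaluate their arguments.\<close>
  let ?c = "inclusion_H.base_chart" and ?d = "inclusion_K.base_chart"
  have c: "?c \<in> atlas N\<^sub>H" "\<one> \<in> fst ?c" and d: "?d \<in> atlas N\<^sub>K" "\<one> \<in> fst ?d"
    using inclusion_H.base_chart inclusion_K.base_chart by (auto simp: charts_at_def)
  obtain e where e: "e \<in> charts_at M \<one>" using charts_at_ex topspace_eq_carrier one_closed by metis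
  then have e': "e \<in> atlas M" "\<one> \<in> fst e" by (auto simp: charts_at_def)
  obtain D where D: "has_chart_deriv (prod_chart ?c ?d) e mu (\<one>, \<one>) D"
    using mu_has_chart_deriv[OF c d e'(1)] e'(2) by auto
  have bij: "surj D" "inj D" and lin: "linear D"
    using mu_deriv_surj[OF c(1) d(1) e'(1) D] mu_deriv_inj[OF c(1) d(1) e'(1) D]
      has_chart_deriv_linear[OF D] by auto
  obtain E where E: "has_chart_deriv ?c e (\<lambda>x. x) \<one> E" "\<And>v. d\<^sub>H v e = E (v ?c)"
    using inclusion_H.deriv_ex[OF e] by blast
  obtain F where F: "has_chart_deriv ?d e (\<lambda>x. x) \<one> F" "\<And>v. d\<^sub>K v e = F (v ?d)"
    using inclusion_K.deriv_ex[OF e] by blast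
  note Pc = has_chart_deriv_Pair_const[OF H.open_chart_atlas[OF c(1)] c(2) d(2)
      K.open_chart_atlas[OF d(1), unfolded open_chart_def, THEN conjunct2, THEN conjunct1]]
  note Pd = has_chart_deriv_Pair_const[OF K.open_chart_atlas[OF d(1)] d(2) c(2)
      H.open_chart_atlas[OF c(1), unfolded open_chart_def, THEN conjunct2, THEN conjunct1]]
  \<comment> \<open>Since \<open>x \<otimes> \<one> = x\<close>, the slice of \<open>mu\<close>
    through \<open>\<one>\<close> is the inclusion of \<open>H\<close>, so a partial derivative of
    \<open>mu\<close> is the differential of that inclusion. The same holds for \<open>K\<close>
    below.\<close>
  have "has_chart_deriv ?c e (\<lambda>x. x) \<one> (D \<circ> (\<lambda>u. (u, 0)))"
    by (rule has_chart_deriv_cong[OF has_chart_deriv_chain[OF Pc(1) D]])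
      (use charts_carrier(1)[OF c(1)] carriers in \<open>auto simp: mu_Pair\<close>)
  then have E_eq: "E u = D (u, 0)" for u
    using has_chart_deriv_unique[OF E(1)] by (metis comp_apply)
  have "has_chart_deriv ?d e (\<lambda>x. x) \<one> (D \<circ> (\<lambda>u. (0, u)))"
    by (rule has_chart_deriv_cong[OF has_chart_deriv_chain[OF Pd(2) D]])
      (use charts_carrier(2)[OF d(1)] carriers in \<open>auto simp: mu_Pair\<close>)
  then have F_eq: "F u = D (0, u)" for u
    using has_chart_deriv_unique[OF F(1)] by (metis comp_apply)
  have sum: "(d\<^sub>H v + d\<^sub>K w) e = D (v ?c, w ?d)" for v w
    using linear_add[OF lin, of "(v ?c, 0)" "(0, w ?d)"] by (simp add: E F E_eq F_eq)
  have sub: "subspace (d\<^sub>H ` tangent_space N\<^sub>H \<one>)" "subspace (d\<^sub>K ` tangent_space N\<^sub>K \<one>)"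
    by (intro linear_subspace_image inclusion_H.linear_differential inclusion_K.linear_differential
        H.subspace_tangent_space K.subspace_tangent_space)+
  have in_T: "d\<^sub>H v + d\<^sub>K w \<in> tangent_space M \<one>" for v w
    by (intro subspace_add[OF subspace_tangent_space] inclusion_H.differential_in_tangent_space
        inclusion_K.differential_in_tangent_space)
  have spanning: "tangent_space M \<one> = {s + t |s t. s \<in> d\<^sub>H ` tangent_space N\<^sub>H \<one> \<and> t \<in> d\<^sub>K ` tangent_space N\<^sub>K \<one>}"
  proof (intro Set.set_eqI iffI)
    fix x assume x: "x \<in> tangent_space M \<one>"
    obtain u w where uw: "x e = D (u, w)" using bij(1) by (metis surjD surj_pair)
    obtain v where v: "v \<in> tangent_space N\<^sub>H \<one>" "v ?c = u"
      using H.tangent_vector_ex[OF inclusion_H.base_chart] by metis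
    obtain v' where v': "v' \<in> tangent_space N\<^sub>K \<one>" "v' ?d = w"
      using K.tangent_vector_ex[OF inclusion_K.base_chart] by metis
    have "x = d\<^sub>H v + d\<^sub>K v'"
      using sum[of v v'] v v' uw by (intro tangent_vector_eqI[OF x in_T e]) simp
    then show "x \<in> {s + t |s t. s \<in> d\<^sub>H ` tangent_space N\<^sub>H \<one> \<and> t \<in> d\<^sub>K ` tangent_space N\<^sub>K \<one>}"
      using v v' by blast
  next
    fix x assume "x \<in> {s + t |s t. s \<in> d\<^sub>H ` tangent_space N\<^sub>H \<one> \<and> t \<in> d\<^sub>K ` tangent_space N\<^sub>K \<one>}"
    then show "x \<in> tangent_space M \<one>" using in_T by blast
  qed
  have trivial: "d\<^sub>H ` tangent_space N\<^sub>H \<one> \<inter> d\<^sub>K ` tangent_space N\<^sub>K \<one> = {0}"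
  proof (intro Set.set_eqI iffI)
    fix x assume "x \<in> d\<^sub>H ` tangent_space N\<^sub>H \<one> \<inter> d\<^sub>K ` tangent_space N\<^sub>K \<one>"
    then obtain v w where v: "v \<in> tangent_space N\<^sub>H \<one>" "x = d\<^sub>H v" and w: "x = d\<^sub>K w" by blast
    \<comment> \<open>Both sides are \<open>x e\<close>, computed once through \<open>H\<close> and
      once through \<open>K\<close>; comparing first components will give
      \<open>v ?c = 0\<close>.\<close>
    have "D (v ?c, 0) = D (0, w ?d)"
      using v(2) w E(2)[of v] F(2)[of w] by (simp add: E_eq F_eq)
    then have "v ?c = 0" using bij(2) by (auto dest: injD)
    then have "v = 0"
      using H.tangent_vector_eqI[OF v(1) subspace_0[OF H.subspace_tangent_space] inclusion_H.base_chart]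
      by simp
    then show "x \<in> {0}" using v(2) linear_0[OF inclusion_H.linear_differential] by simp
  next
    fix x :: "('a, 'e) tangent_vector" assume "x \<in> {0}"
    then show "x \<in> d\<^sub>H ` tangent_space N\<^sub>H \<one> \<inter> d\<^sub>K ` tangent_space N\<^sub>K \<one>"
      using sub subspace_0 by auto
  qed
  show ?thesis
    unfolding is_direct_sum_def by (intro conjI sub subspace_tangent_space spanning trivial)
qed

end

theorem proposition3p3:
  fixes G :: "('a, 'm) monoid_scheme"
    and M :: "('a, 'e::real_normed_vector) manifold"
    and H K :: "'a set"
    and N\<^sub>H :: "('a, 'f::real_normed_vector) manifold"
    and N\<^sub>K :: "('a, 'g::real_normed_vector) manifold"
  assumes "lie_group G M"
    and "lie_subgroup G M H N\<^sub>H"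
    and "lie_subgroup G M K N\<^sub>K"
    and "zappa_szep_product G H K"
  shows "is_direct_sum (carrier (lie_algebra G M))
           (lie_subalgebra_of G M H N\<^sub>H) (lie_subalgebra_of G M K N\<^sub>K)"
proof -
  interpret zappa_szep_lie_groups G M H K N\<^sub>H N\<^sub>K
    using assms by (simp add: zappa_szep_lie_groups_def zappa_szep_lie_groups_axioms_def)
  \<comment> \<open>Replacing the carrier of \<open>G\<close> leaves \<open>\<one>\<close>
    unchanged, so all three Lie algebras have tangent spaces at the same point as carriers.\<close>
  show ?thesis
    using tangent_spaces_direct_sum by (simp add: lie_algebra_def lie_subalgebra_of_def)
qed

end
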